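(* The canonical map $$\kappa \colon \operatorname{Sd}(\Delta[m] \times \Delta[n]) \longrightarrow \operatorname{Sd} \Delta[m] \times \operatorname{Sd} \Delta[n], \qquad \kappa = (\operatorname{Sd}(\mathrm{pr}_1), \operatorname{Sd}(\mathrm{pr}_2)),$$ is simple, for each $m\ge0$ and $n\ge0$.
   Context: A simplicial set is finite if it has only finitely many non-degenerate simplices. $|\cdot|$ denotes geometric realization. A map $f \colon A \to B$ of finite simplicial sets is called simple if for each point $b \in |B|$ the preimage $|f|^{-1}(b)$ under $|f| \colon |A| \to |B|$ is contractible. Kan subdivision: $\Delta[n]$ denotes the standard $n$-simplex. Let $\Delta[n]^\#$ be the set of non-degenerate simplices of $\Delta[n]$, partially ordered by $x \le y$ if $x$ is a face of $y$ (equivalently, the poset of non-empty subsets of $[n]=\{0<1<\dots<n\}$ under inclusion). An operator $\alpha \colon [n] \to [p]$ (order-preserving function) induces the order-preserving function $\Delta[n]^\# \to \Delta[p]^\#$ that takes a non-empty subset to its image. The Kan subdivision $\operatorname{Sd}$, a functor from simplicial sets to simplicial sets, is the left Kan extension of the functor $[n] \mapsto N(\Delta[n]^\#)$ (nerve of the poset) along the Yoneda embedding $[n] \mapsto \Delta[n]$. $\mathrm{pr}_1$ and $\mathrm{pr}_2$ are the projections from $\Delta[m] \times \Delta[n]$ to $\Delta[m]$ and $\Delta[n]$. *)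

theory Defs
  imports "HOL-Homology.Simplices"
begin

section \<open>Simplicial sets\<close>

text \<open>Order-preserving functions from $\{0<\dots<n\}$ to $\{0<\dots<p\}$.\<close>

definition opers :: "nat \<Rightarrow> nat \<Rightarrow> (nat \<Rightarrow> nat) set" where
  "opers n p = {\<alpha> \<in> {..n} \<rightarrow>\<^sub>E {..p}. mono_on {..n} \<alpha>}"

text \<open>For \<open>\<alpha> \<in> opers k q\<close>, the function \<open>act X k q \<alpha>\<close> is the map
  \<open>\<alpha>\<^sup>*\<close> from the \<open>q\<close>-simplices to the \<open>k\<close>-simplices of \<open>X\<close>.\<close>

record 'a sset =
  cells :: "nat \<Rightarrow> 'a set"
  act :: "nat \<Rightarrow> nat \<Rightarrow> (nat \<Rightarrow> nat) \<Rightarrow> 'a \<Rightarrow> 'a"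

locale simplicial_set =
  fixes X :: "'a sset"
  assumes act_closed: "\<lbrakk>\<alpha> \<in> opers k q; x \<in> cells X q\<rbrakk> \<Longrightarrow> act X k q \<alpha> x \<in> cells X k"
    and act_id: "x \<in> cells X q \<Longrightarrow> act X q q (\<lambda>i\<in>{..q}. i) x = x"
    and act_comp: "\<lbrakk>\<beta> \<in> opers j k; \<alpha> \<in> opers k q; x \<in> cells X q\<rbrakk>
      \<Longrightarrow> act X j q (compose {..j} \<alpha> \<beta>) x = act X j k \<beta> (act X k q \<alpha> x)"

definition simplicial_map :: "'a sset \<Rightarrow> 'b sset \<Rightarrow> (nat \<Rightarrow> 'a \<Rightarrow> 'b) \<Rightarrow> bool" where
  "simplicial_map X Y f \<longleftrightarrow>
     (\<forall>q. \<forall>x\<in>cells X q. f q x \<in> cells Y q) \<and>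
     (\<forall>k q \<alpha> x. \<alpha> \<in> opers k q \<longrightarrow> x \<in> cells X q \<longrightarrow> f k (act X k q \<alpha> x) = act Y k q \<alpha> (f q x))"

definition degenerate :: "'a sset \<Rightarrow> nat \<Rightarrow> 'a \<Rightarrow> bool" where
  "degenerate X q x \<longleftrightarrow>
     (\<exists>k<q. \<exists>\<sigma>\<in>opers q k. \<exists>y\<in>cells X k. \<sigma> ` {..q} = {..k} \<and> x = act X q k \<sigma> y)"

definition nondegenerate_simplices :: "'a sset \<Rightarrow> (nat \<times> 'a) set" where
  "nondegenerate_simplices X = {(q, x). x \<in> cells X q \<and> \<not> degenerate X q x}"

definition finite_sset :: "'a sset \<Rightarrow> bool" where
  "finite_sset X \<longleftrightarrow> simplicial_set X \<and> finite (nondegenerate_simplices X)"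

definition Delta :: "nat \<Rightarrow> (nat \<Rightarrow> nat) sset" where
  "Delta n = \<lparr>cells = (\<lambda>q. opers q n), act = (\<lambda>k q \<alpha> x. compose {..k} x \<alpha>)\<rparr>"

definition sset_prod :: "'a sset \<Rightarrow> 'b sset \<Rightarrow> ('a \<times> 'b) sset" (infixr "\<times>\<^sub>s" 80) where
  "X \<times>\<^sub>s Y = \<lparr>cells = (\<lambda>q. cells X q \<times> cells Y q),
             act = (\<lambda>k q \<alpha>. map_prod (act X k q \<alpha>) (act Y k q \<alpha>))\<rparr>"

definition pr1 :: "nat \<Rightarrow> 'a \<times> 'b \<Rightarrow> 'a" where "pr1 q = fst"

definition pr2 :: "nat \<Rightarrow> 'a \<times> 'b \<Rightarrow> 'b" where "pr2 q = snd"

definition sset_pair ::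
    "(nat \<Rightarrow> 'a \<Rightarrow> 'b) \<Rightarrow> (nat \<Rightarrow> 'a \<Rightarrow> 'c) \<Rightarrow> nat \<Rightarrow> 'a \<Rightarrow> 'b \<times> 'c" where
  "sset_pair f g q x = (f q x, g q x)"

text \<open>The nerve of a set \<open>P\<close> partially ordered by \<open>\<le>\<close>.\<close>

definition nerve :: "'a::order set \<Rightarrow> (nat \<Rightarrow> 'a) sset" where
  "nerve P = \<lparr>cells = (\<lambda>q. {c \<in> {..q} \<rightarrow>\<^sub>E P. mono_on {..q} c}),
              act = (\<lambda>k q \<alpha> c. compose {..k} c \<alpha>)\<rparr>"

definition nerve_map :: "('a \<Rightarrow> 'b) \<Rightarrow> nat \<Rightarrow> (nat \<Rightarrow> 'a) \<Rightarrow> nat \<Rightarrow> 'b" where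
  "nerve_map f q c = compose {..q} f c"


section \<open>Gluing along a simplicial set\<close>

text \<open>For a simplicial set \<open>X\<close> and a covariant functor from the simplex category to sets,
  with object part \<open>F\<close> and morphism part \<open>G\<close>, the set \<open>coend X F G\<close> is the quotient of the
  disjoint union of the sets \<open>cells X n \<times> F n\<close> by the equivalence relation generated by
  \<open>(\<alpha>\<^sup>* x, u) \<sim> (x, \<alpha>\<^sub>* u)\<close>. Equivalently it is the colimit of \<open>F\<close> over the category of
  simplices of \<open>X\<close>, that is, the value at \<open>X\<close> of the left Kan extension of the functor along
  the Yoneda embedding.\<close>

inductive coend_rel ::
    "'a sset \<Rightarrow> (nat \<Rightarrow> 'u set) \<Rightarrow> (nat \<Rightarrow> nat \<Rightarrow> (nat \<Rightarrow> nat) \<Rightarrow> 'u \<Rightarrow> 'u) \<Rightarrow>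
     nat \<times> 'a \<times> 'u \<Rightarrow> nat \<times> 'a \<times> 'u \<Rightarrow> bool"
  for X F G where
  coend_relI: "\<lbrakk>\<alpha> \<in> opers n p; x \<in> cells X p; u \<in> F n\<rbrakk>
    \<Longrightarrow> coend_rel X F G (n, act X n p \<alpha> x, u) (p, x, G n p \<alpha> u)"

definition coend_class ::
    "'a sset \<Rightarrow> (nat \<Rightarrow> 'u set) \<Rightarrow> (nat \<Rightarrow> nat \<Rightarrow> (nat \<Rightarrow> nat) \<Rightarrow> 'u \<Rightarrow> 'u) \<Rightarrow>
     nat \<times> 'a \<times> 'u \<Rightarrow> (nat \<times> 'a \<times> 'u) set" where
  "coend_class X F G z = {w. equivclp (coend_rel X F G) z w}"

definition coend ::
    "'a sset \<Rightarrow> (nat \<Rightarrow> 'u set) \<Rightarrow> (nat \<Rightarrow> nat \<Rightarrow> (nat \<Rightarrow> nat) \<Rightarrow> 'u \<Rightarrow> 'u) \<Rightarrow>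
     (nat \<times> 'a \<times> 'u) set set" where
  "coend X F G = {coend_class X F G (n, x, u) | n x u. x \<in> cells X n \<and> u \<in> F n}"

text \<open>The function on equivalence classes induced by a function \<open>h\<close> on representatives that
  is constant on each class.\<close>

definition coend_lift :: "('z \<Rightarrow> 'c) \<Rightarrow> 'z set \<Rightarrow> 'c" where
  "coend_lift h C = the_elem (h ` C)"

lemma coend_class_eqI:
  assumes "\<alpha> \<in> opers n p" "x \<in> cells X p" "u \<in> F n"
  shows "coend_class X F G (n, act X n p \<alpha> x, u) = coend_class X F G (p, x, G n p \<alpha> u)"
proof -
  have "equivclp (coend_rel X F G) (n, act X n p \<alpha> x, u) (p, x, G n p \<alpha> u)"
    by (rule r_into_equivclp) (rule coend_relI; fact assms)
  then show ?thesis
    using equivp_evquivclp[of "coend_rel X F G"] unfolding coend_class_def equivp_def by metis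
qed

lemma coend_lift_class:
  assumes "\<And>n p \<alpha> x u. \<lbrakk>\<alpha> \<in> opers n p; x \<in> cells X p; u \<in> F n\<rbrakk>
    \<Longrightarrow> h (n, act X n p \<alpha> x, u) = h (p, x, G n p \<alpha> u)"
  shows "coend_lift h (coend_class X F G z) = h z"
proof -
  have "h w = h z" if "equivclp (coend_rel X F G) z w" for w
    using that
  proof induction
    case (step y w)
    have "h a = h b" if "coend_rel X F G a b" for a b
      using that by cases (use assms in blast)
    with step show ?case by metis
  qed simp
  moreover have "z \<in> coend_class X F G z" by (simp add: coend_class_def)
  ultimately have "h ` coend_class X F G z = {h z}" unfolding coend_class_def by blast
  then show ?thesis by (simp add: coend_lift_def)
qed


section \<open>Kan subdivision\<close>

text \<open>The poset of non-degenerate simplices of \<open>Delta n\<close>, a simplex being identified with its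
  set of vertices; the order of the type \<open>nat set\<close> is inclusion.\<close>

definition faces :: "nat \<Rightarrow> nat set set" where
  "faces n = {S. S \<noteq> {} \<and> S \<subseteq> {..n}}"

abbreviation Sd_class ::
    "'a sset \<Rightarrow> nat \<Rightarrow> nat \<times> 'a \<times> (nat \<Rightarrow> nat set) \<Rightarrow> (nat \<times> 'a \<times> (nat \<Rightarrow> nat set)) set" where
  "Sd_class X q \<equiv>
     coend_class X (\<lambda>n. cells (nerve (faces n)) q) (\<lambda>n p \<alpha>. nerve_map ((`) \<alpha>) q)"

text \<open>Colimits of simplicial sets are formed degreewise, so the left Kan extension is computed
  separately in each degree \<open>q\<close>.\<close>

definition Sd :: "'a sset \<Rightarrow> (nat \<times> 'a \<times> (nat \<Rightarrow> nat set)) set sset" where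
  "Sd X = \<lparr>cells = (\<lambda>q. coend X (\<lambda>n. cells (nerve (faces n)) q) (\<lambda>n p \<alpha>. nerve_map ((`) \<alpha>) q)),
           act = (\<lambda>k q \<beta>. coend_lift (\<lambda>(n, x, c).
                    Sd_class X k (n, x, act (nerve (faces n)) k q \<beta> c)))\<rparr>"

text \<open>\<open>Sd_map Y f\<close> is \<open>Sd f\<close> for a simplicial map \<open>f\<close> with target \<open>Y\<close>.\<close>

definition Sd_map ::
    "'b sset \<Rightarrow> (nat \<Rightarrow> 'a \<Rightarrow> 'b) \<Rightarrow> nat \<Rightarrow> (nat \<times> 'a \<times> (nat \<Rightarrow> nat set)) set \<Rightarrow>
     (nat \<times> 'b \<times> (nat \<Rightarrow> nat set)) set" where
  "Sd_map Y f q = coend_lift (\<lambda>(n, x, c). Sd_class Y q (n, f n x, c))"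

definition kappa ::
    "nat \<Rightarrow> nat \<Rightarrow> nat \<Rightarrow> (nat \<times> ((nat \<Rightarrow> nat) \<times> (nat \<Rightarrow> nat)) \<times> (nat \<Rightarrow> nat set)) set \<Rightarrow>
     (nat \<times> (nat \<Rightarrow> nat) \<times> (nat \<Rightarrow> nat set)) set \<times> (nat \<times> (nat \<Rightarrow> nat) \<times> (nat \<Rightarrow> nat set)) set" where
  "kappa m n = sset_pair (Sd_map (Delta m) pr1) (Sd_map (Delta n) pr2)"


section \<open>Geometric realization\<close>

text \<open>The affine map of standard simplices sending vertex \<open>i\<close> to vertex \<open>\<alpha> i\<close>.\<close>

definition affine_op :: "nat \<Rightarrow> nat \<Rightarrow> (nat \<Rightarrow> nat) \<Rightarrow> (nat \<Rightarrow> real) \<Rightarrow> nat \<Rightarrow> real" where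
  "affine_op n p \<alpha> t = (\<lambda>j. \<Sum>i | i \<le> n \<and> \<alpha> i = j. t i)"

abbreviation rclass :: "'a sset \<Rightarrow> nat \<times> 'a \<times> (nat \<Rightarrow> real) \<Rightarrow> (nat \<times> 'a \<times> (nat \<Rightarrow> real)) set" where
  "rclass X \<equiv> coend_class X standard_simplex affine_op"

text \<open>The quotient topology, the cells of \<open>X\<close> being discrete and the standard simplices having
  their Euclidean topology.\<close>

definition realization :: "'a sset \<Rightarrow> (nat \<times> 'a \<times> (nat \<Rightarrow> real)) set topology" where
  "realization X = topology (\<lambda>U. U \<subseteq> coend X standard_simplex affine_op \<and>
     (\<forall>n. \<forall>x\<in>cells X n. openin (subtopology (powertop_real UNIV) (standard_simplex n))
                           {t \<in> standard_simplex n. rclass X (n, x, t) \<in> U}))"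

text \<open>\<open>realization_map Y f\<close> is \<open>|f|\<close> for a simplicial map \<open>f\<close> with target \<open>Y\<close>.\<close>

definition realization_map ::
    "'b sset \<Rightarrow> (nat \<Rightarrow> 'a \<Rightarrow> 'b) \<Rightarrow> (nat \<times> 'a \<times> (nat \<Rightarrow> real)) set \<Rightarrow>
     (nat \<times> 'b \<times> (nat \<Rightarrow> real)) set" where
  "realization_map Y f = coend_lift (\<lambda>(n, x, t). rclass Y (n, f n x, t))"


section \<open>Simple maps\<close>

text \<open>The library's \<open>contractible_space\<close> holds of the empty space, so that non-emptiness has to
  be demanded separately.\<close>

definition simple_map :: "'a sset \<Rightarrow> 'b sset \<Rightarrow> (nat \<Rightarrow> 'a \<Rightarrow> 'b) \<Rightarrow> bool" where
  "simple_map A B f \<longleftrightarrow>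
     finite_sset A \<and> finite_sset B \<and> simplicial_map A B f \<and>
     (\<forall>b \<in> topspace (realization B).
        let P = {a \<in> topspace (realization A). realization_map B f a = b}
        in P \<noteq> {} \<and> contractible_space (subtopology (realization A) P))"


section \<open>Well-definedness\<close>

lemma opers_comp: "\<lbrakk>\<beta> \<in> opers j k; \<alpha> \<in> opers k q\<rbrakk> \<Longrightarrow> compose {..j} \<alpha> \<beta> \<in> opers j q"
  unfolding opers_def by (auto simp: compose_def monotone_on_def PiE_iff)

lemma opers_le: "\<lbrakk>\<beta> \<in> opers j k; i \<le> j\<rbrakk> \<Longrightarrow> \<beta> i \<le> k"
  unfolding opers_def by auto

lemma simplicial_set_nerve: "simplicial_set (nerve P)"
proof
  show "act (nerve P) k q \<alpha> x \<in> cells (nerve P) k"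
    if "\<alpha> \<in> opers k q" "x \<in> cells (nerve P) q" for \<alpha> k q x
    using that unfolding opers_def nerve_def by (auto simp: compose_def monotone_on_def PiE_iff)
  show "act (nerve P) q q (\<lambda>i\<in>{..q}. i) x = x" if "x \<in> cells (nerve P) q" for q x
    using that by (auto simp: nerve_def compose_def fun_eq_iff PiE_iff extensional_def)
  show "act (nerve P) j q (compose {..j} \<alpha> \<beta>) x = act (nerve P) j k \<beta> (act (nerve P) k q \<alpha> x)"
    if "\<beta> \<in> opers j k" "\<alpha> \<in> opers k q" "x \<in> cells (nerve P) q" for \<alpha> \<beta> j k q x
    using that by (auto simp: nerve_def compose_def fun_eq_iff opers_le)
qed

lemma Delta_eq_nerve: "Delta n = nerve {..n}"
  by (simp add: Delta_def nerve_def opers_def)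

lemma simplicial_set_Delta: "simplicial_set (Delta n)"
  unfolding Delta_eq_nerve by (rule simplicial_set_nerve)

lemma simplicial_set_prod:
  assumes "simplicial_set X" "simplicial_set Y" shows "simplicial_set (X \<times>\<^sub>s Y)"
proof -
  interpret X: simplicial_set X by fact
  interpret Y: simplicial_set Y by fact
  show ?thesis
    by standard (auto simp: sset_prod_def X.act_closed Y.act_closed X.act_id Y.act_id
        X.act_comp Y.act_comp)
qed

lemma simplicial_map_pr1: "simplicial_map (X \<times>\<^sub>s Y) X pr1"
  by (auto simp: simplicial_map_def sset_prod_def pr1_def)

lemma simplicial_map_pr2: "simplicial_map (X \<times>\<^sub>s Y) Y pr2"
  by (auto simp: simplicial_map_def sset_prod_def pr2_def)

lemma simplicial_map_pair:
  "\<lbrakk>simplicial_map Z X f; simplicial_map Z Y g\<rbrakk> \<Longrightarrow> simplicial_map Z (X \<times>\<^sub>s Y) (sset_pair f g)"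
  by (auto simp: simplicial_map_def sset_prod_def sset_pair_def)

lemma image_faces: "\<lbrakk>\<alpha> \<in> opers n p; S \<in> faces n\<rbrakk> \<Longrightarrow> \<alpha> ` S \<in> faces p"
  by (auto simp: faces_def opers_def)

lemma nerve_map_faces:
  "\<lbrakk>\<alpha> \<in> opers n p; c \<in> cells (nerve (faces n)) q\<rbrakk>
    \<Longrightarrow> nerve_map ((`) \<alpha>) q c \<in> cells (nerve (faces p)) q"
  using image_faces[of \<alpha> n p]
  by (fastforce simp: nerve_def nerve_map_def compose_def monotone_on_def PiE_iff)

lemma simplicial_map_nerve_map:
  assumes "\<alpha> \<in> opers n p"
  shows "simplicial_map (nerve (faces n)) (nerve (faces p)) (nerve_map ((`) \<alpha>))"
  using nerve_map_faces[OF assms]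
  by (auto simp: simplicial_map_def nerve_def nerve_map_def compose_def fun_eq_iff opers_le)

lemma act_Sd_class:
  assumes "\<beta> \<in> opers k q"
  shows "act (Sd X) k q \<beta> (Sd_class X q (n, x, c)) =
    Sd_class X k (n, x, act (nerve (faces n)) k q \<beta> c)"
proof -
  interpret N: simplicial_set "nerve (faces n)" for n by (rule simplicial_set_nerve)
  show ?thesis unfolding Sd_def sset.simps
  proof (subst coend_lift_class, simp_all)
    fix n p \<alpha> x u
    assume a: "\<alpha> \<in> opers n p" "x \<in> cells X p" "u \<in> cells (nerve (faces n)) q"
    have "act (nerve (faces p)) k q \<beta> (nerve_map ((`) \<alpha>) q u)
        = nerve_map ((`) \<alpha>) k (act (nerve (faces n)) k q \<beta> u)"
      using simplicial_map_nerve_map[OF a(1)] assms a(3) by (simp add: simplicial_map_def)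
    then show "Sd_class X k (n, act X n p \<alpha> x, act (nerve (faces n)) k q \<beta> u) =
       Sd_class X k (p, x, act (nerve (faces p)) k q \<beta> (nerve_map ((`) \<alpha>) q u))"
      using coend_class_eqI[where F="\<lambda>n. cells (nerve (faces n)) k", OF a(1,2) N.act_closed[OF assms a(3)]] by simp
  qed
qed

lemma cells_Sd:
  "cells (Sd X) q = {Sd_class X q (n, x, c) | n x c. x \<in> cells X n \<and> c \<in> cells (nerve (faces n)) q}"
  by (simp add: Sd_def coend_def)

lemma simplicial_set_Sd: "simplicial_set (Sd X)"
proof -
  interpret N: simplicial_set "nerve (faces n)" for n by (rule simplicial_set_nerve)
  show ?thesis
  proof
    show "act (Sd X) k q \<alpha> x \<in> cells (Sd X) k"
      if "\<alpha> \<in> opers k q" "x \<in> cells (Sd X) q" for \<alpha> k q x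
      using that N.act_closed by (fastforce simp: cells_Sd act_Sd_class)
    show "act (Sd X) q q (\<lambda>i\<in>{..q}. i) x = x" if "x \<in> cells (Sd X) q" for q x
    proof -
      have "(\<lambda>i\<in>{..q}. i) \<in> opers q q" by (auto simp: opers_def monotone_on_def)
      then show ?thesis using that N.act_id by (fastforce simp: cells_Sd act_Sd_class)
    qed
    show "act (Sd X) j q (compose {..j} \<alpha> \<beta>) x = act (Sd X) j k \<beta> (act (Sd X) k q \<alpha> x)"
      if "\<beta> \<in> opers j k" "\<alpha> \<in> opers k q" "x \<in> cells (Sd X) q" for \<alpha> \<beta> j k q x
      using that N.act_comp[OF that(1,2)] opers_comp[OF that(1,2)]
      by (auto simp: cells_Sd act_Sd_class)
  qed
qed

lemma Sd_map_class:
  assumes "simplicial_map X Y f"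
  shows "Sd_map Y f q (Sd_class X q (n, x, c)) = Sd_class Y q (n, f n x, c)"
  unfolding Sd_map_def
proof (subst coend_lift_class, simp_all)
  fix n p \<alpha> x u
  assume a: "\<alpha> \<in> opers n p" "x \<in> cells X p" "u \<in> cells (nerve (faces n)) q"
  have f: "f n (act X n p \<alpha> x) = act Y n p \<alpha> (f p x)" "f p x \<in> cells Y p"
    using assms a by (auto simp: simplicial_map_def)
  then show "Sd_class Y q (n, f n (act X n p \<alpha> x), u) =
     Sd_class Y q (p, f p x, nerve_map ((`) \<alpha>) q u)"
    using coend_class_eqI[where F="\<lambda>n. cells (nerve (faces n)) q", OF a(1) f(2) a(3)] by simp
qed

lemma simplicial_map_Sd_map:
  assumes f: "simplicial_map X Y f"
  shows "simplicial_map (Sd X) (Sd Y) (Sd_map Y f)"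
proof -
  have "f q x \<in> cells Y q" if "x \<in> cells X q" for q x
    using f that by (auto simp: simplicial_map_def)
  then show ?thesis
    unfolding simplicial_map_def
    by (fastforce simp: cells_Sd Sd_map_class[OF f] act_Sd_class)
qed

lemma simplicial_map_kappa:
  "simplicial_map (Sd (Delta m \<times>\<^sub>s Delta n)) (Sd (Delta m) \<times>\<^sub>s Sd (Delta n)) (kappa m n)"
  unfolding kappa_def
  by (intro simplicial_map_pair simplicial_map_Sd_map simplicial_map_pr1 simplicial_map_pr2)

text \<open>The universal property of \<open>Sd X\<close> as the colimit, over the simplices \<open>x\<close> of \<open>X\<close>, of
  the nerves of the posets \<open>faces n\<close>.\<close>

lemma Sd_cocone:
  assumes x: "x \<in> cells X n"
  shows "simplicial_map (nerve (faces n)) (Sd X) (\<lambda>q c. Sd_class X q (n, x, c))"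
  using x by (auto simp: simplicial_map_def cells_Sd act_Sd_class)

lemma Sd_universal:
  fixes \<phi> :: "nat \<Rightarrow> 'a \<Rightarrow> nat \<Rightarrow> (nat \<Rightarrow> nat set) \<Rightarrow> 'b"
  assumes map: "\<And>n x. x \<in> cells X n \<Longrightarrow> simplicial_map (nerve (faces n)) Y (\<phi> n x)"
    and compat: "\<And>n p \<alpha> x q c. \<lbrakk>\<alpha> \<in> opers n p; x \<in> cells X p; c \<in> cells (nerve (faces n)) q\<rbrakk>
      \<Longrightarrow> \<phi> n (act X n p \<alpha> x) q c = \<phi> p x q (nerve_map ((`) \<alpha>) q c)"
  shows "\<exists>g. simplicial_map (Sd X) Y g \<and>
      (\<forall>n q. \<forall>x\<in>cells X n. \<forall>c\<in>cells (nerve (faces n)) q. g q (Sd_class X q (n, x, c)) = \<phi> n x q c) \<and>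
      (\<forall>g'. simplicial_map (Sd X) Y g' \<longrightarrow>
         (\<forall>n q. \<forall>x\<in>cells X n. \<forall>c\<in>cells (nerve (faces n)) q. g' q (Sd_class X q (n, x, c)) = \<phi> n x q c)
         \<longrightarrow> (\<forall>q. \<forall>z\<in>cells (Sd X) q. g' q z = g q z))"
proof -
  define g where "g q = coend_lift (\<lambda>(n, x, c). \<phi> n x q c)" for q
  have g: "g q (Sd_class X q (n, x, c)) = \<phi> n x q c" for q n x c
    unfolding g_def by (subst coend_lift_class) (use compat in auto)
  have "simplicial_map (Sd X) Y g"
    using map unfolding simplicial_map_def by (fastforce simp: cells_Sd g act_Sd_class)
  then show ?thesis
    by (intro exI[of _ g]) (auto simp: g cells_Sd)
qed

lemma openin_realization:
  "openin (realization X) U \<longleftrightarrow> U \<subseteq> coend X standard_simplex affine_op \<and>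
     (\<forall>n. \<forall>x\<in>cells X n. openin (subtopology (powertop_real UNIV) (standard_simplex n))
                           {t \<in> standard_simplex n. rclass X (n, x, t) \<in> U})"
proof -
  have I: "{t \<in> A. r t \<in> S \<inter> T} = {t \<in> A. r t \<in> S} \<inter> {t \<in> A. r t \<in> T}"
    and U: "{t \<in> A. r t \<in> \<Union>K} = (\<Union>S\<in>K. {t \<in> A. r t \<in> S})"
    for A :: "(nat \<Rightarrow> real) set" and r :: "(nat \<Rightarrow> real) \<Rightarrow> (nat \<times> 'a \<times> (nat \<Rightarrow> real)) set" and S T K
    by auto
  have "istopology (\<lambda>U. U \<subseteq> coend X standard_simplex affine_op \<and>
     (\<forall>n. \<forall>x\<in>cells X n. openin (subtopology (powertop_real UNIV) (standard_simplex n))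
                           {t \<in> standard_simplex n. rclass X (n, x, t) \<in> U}))"
    unfolding istopology_def I U by (auto intro!: openin_Int openin_Union)
  then show ?thesis unfolding realization_def by (simp add: topology_inverse')
qed

lemma topspace_realization: "topspace (realization X) = coend X standard_simplex affine_op"
proof -
  have "{t \<in> standard_simplex n. rclass X (n, x, t) \<in> coend X standard_simplex affine_op}
      = standard_simplex n" if "x \<in> cells X n" for n x
    using that by (auto simp: coend_def)
  then have "openin (realization X) (coend X standard_simplex affine_op)"
    using openin_topspace[of "subtopology (powertop_real UNIV) (standard_simplex n)" for n]
    by (auto simp: openin_realization)
  then show ?thesis
    by (metis openin_realization openin_subset openin_topspace subset_antisym)
qed

lemma affine_op_standard_simplex:
  assumes \<alpha>: "\<alpha> \<in> opers n p" and t: "t \<in> standard_simplex n"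
  shows "affine_op n p \<alpha> t \<in> standard_simplex p"
proof -
  have nn: "0 \<le> t i" and s1: "(\<Sum>i\<le>n. t i) = 1" for i
    using t by (auto simp: standard_simplex_def)
  have "affine_op n p \<alpha> t j \<le> (\<Sum>i\<le>n. t i)" for j
    unfolding affine_op_def by (rule sum_mono2) (use nn in auto)
  moreover have "affine_op n p \<alpha> t j = 0" if "j > p" for j
  proof -
    have "{i. i \<le> n \<and> \<alpha> i = j} = {}" using opers_le[OF \<alpha>] that by force
    then show ?thesis unfolding affine_op_def by (simp only: sum.empty)
  qed
  moreover have "(\<Sum>j\<le>p. affine_op n p \<alpha> t j) = 1"
    using sum.group[of "{..n}" "{..p}" \<alpha> t] opers_le[OF \<alpha>] s1
    by (auto simp: affine_op_def)
  ultimately show ?thesis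
    using s1 nn by (simp add: standard_simplex_def affine_op_def sum_nonneg)
qed

lemma realization_map_class:
  assumes "simplicial_map X Y f"
  shows "realization_map Y f (rclass X (n, x, t)) = rclass Y (n, f n x, t)"
  unfolding realization_map_def
proof (subst coend_lift_class, simp_all)
  fix n p \<alpha> x and u :: "nat \<Rightarrow> real"
  assume a: "\<alpha> \<in> opers n p" "x \<in> cells X p" "u \<in> standard_simplex n"
  have f: "f n (act X n p \<alpha> x) = act Y n p \<alpha> (f p x)" "f p x \<in> cells Y p"
    using assms a by (auto simp: simplicial_map_def)
  then show "rclass Y (n, f n (act X n p \<alpha> x), u) = rclass Y (p, f p x, affine_op n p \<alpha> u)"
    using coend_class_eqI[where F=standard_simplex, OF a(1) f(2) a(3)] by simp
qed

lemma continuous_map_realization_map: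
  assumes f: "simplicial_map X Y f"
  shows "continuous_map (realization X) (realization Y) (realization_map Y f)"
  unfolding continuous_map_def
proof (intro conjI allI impI)
  have fc: "f q x \<in> cells Y q" if "x \<in> cells X q" for q x
    using f that by (auto simp: simplicial_map_def)
  show "realization_map Y f \<in> topspace (realization X) \<rightarrow> topspace (realization Y)"
    using fc by (fastforce simp: topspace_realization coend_def realization_map_class[OF f])
  fix U assume U: "openin (realization Y) U"
  have "{t \<in> standard_simplex n. rclass X (n, x, t) \<in>
           {a \<in> coend X standard_simplex affine_op. realization_map Y f a \<in> U}}
      = {t \<in> standard_simplex n. rclass Y (n, f n x, t) \<in> U}" if "x \<in> cells X n" for n x
    using that by (auto simp: coend_def realization_map_class[OF f])
  then show "openin (realization X) {a \<in> topspace (realization X). realization_map Y f a \<in> U}"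
    using U fc unfolding openin_realization topspace_realization by auto
qed

end

theory Submission
  imports Defs "HOL-Library.Product_Order"
begin

text \<open>The subdivision of a nerve is the nerve of the poset of finite non-empty chains, so the domain and
  the codomain of \<open>\<kappa>\<close> are nerves of finite posets of finite sets. A point of the realization of such a
  nerve, given by weights \<open>t\<^sub>0, \<dots>, t\<^sub>q\<close> on a flag \<open>S\<^sub>0 \<subset> \<dots> \<subset> S\<^sub>q\<close>, is recovered from its height function
  \<open>\<Sum>\<^sub>l t\<^sub>l 1\<^bsub>S\<^sub>l\<^esub>\<close>. In these coordinates the domain consists of the functions \<open>g\<close> on the
  grid \<open>{..m} \<times> {..n}\<close> with maximum 1 whose support is a chain, and \<open>|\<kappa>|\<close> sends \<open>g\<close> to its row maxima and
  its column maxima. Hence the fibre over \<open>(h1, h2)\<close> is the space of all \<open>g\<close> supported on a chain and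
  with prescribed row maxima \<open>h1\<close> and column maxima \<open>h2\<close>. Every superlevel set of such a \<open>g\<close> is a
  staircase path, and the lower envelope of two paths makes the fibre a topological semilattice.
  A moving staircase, swept across the grid compatibly with all levels at once, then contracts the
  fibre.\<close>


section \<open>Nerves and subdivisions\<close>

text \<open>The fibre has no affine contraction: a convex combination of functions supported on two
  different chains need not be supported on a chain. For the same reason envelopes are not pointwise
  maxima or minima of couplings; they are formed on the pairs of regions on either side of a path. A
  semilattice operation alone gives no path from \<open>g\<close> to its meet with
  \<open>g'\<close>. The path comes from a third staircase \<sigma>, moving from the highest to the
  lowest position: the meet of \<open>g\<close> with the join of \<open>g'\<close> and \<sigma> runs
  from \<open>g\<close> to the meet of \<open>g\<close> and \<open>g'\<close>. The sweep \<sigma>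
  violates the boundary conditions, but the expression always lies between this meet and
  \<open>g\<close>, which restores them. The main obstacle is that a staircase has to be unbroken at
  all levels simultaneously, although the grid shrinks as the level rises. An ordinary sweep of the
  full grid could pass through rows and columns that are missing at a higher level; this forces
  interval lengths that grow very fast with the values. Contractibility does not include
  non-emptiness here. Fibres are non-empty because \<kappa> is onto on simplices, a statement about
  flags of chains.\<close>

definition nerve_iso :: "'a sset \<Rightarrow> (nat \<Rightarrow> 'a \<Rightarrow> nat \<Rightarrow> 'v::order) \<Rightarrow> 'v set \<Rightarrow> bool" where
  "nerve_iso X E P \<longleftrightarrow>
     simplicial_map X (nerve P) E \<and> (\<forall>q. bij_betw (E q) (cells X q) (cells (nerve P) q))"

lemma cells_nerve: "cells (nerve P) q = {c \<in> {..q} \<rightarrow>\<^sub>E P. mono_on {..q} c}"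
  by (simp add: nerve_def)

lemma act_nerve: "act (nerve P) k q \<alpha> c = compose {..k} c \<alpha>"
  by (simp add: nerve_def)

lemma nerve_isoD:
  assumes "nerve_iso X E P" "x \<in> cells X q"
  shows "E q x \<in> cells (nerve P) q"
    "i \<le> q \<Longrightarrow> E q x i \<in> P"
    "i \<le> j \<Longrightarrow> j \<le> q \<Longrightarrow> E q x i \<le> E q x j"
    "\<alpha> \<in> opers k q \<Longrightarrow> i \<le> k \<Longrightarrow> E k (act X k q \<alpha> x) i = E q x (\<alpha> i)"
proof -
  show E: "E q x \<in> cells (nerve P) q"
    using assms by (auto simp: nerve_iso_def simplicial_map_def)
  then show "i \<le> q \<Longrightarrow> E q x i \<in> P" "i \<le> j \<Longrightarrow> j \<le> q \<Longrightarrow> E q x i \<le> E q x j"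
    by (simp_all add: cells_nerve PiE_iff monotone_on_def)
  show "\<alpha> \<in> opers k q \<Longrightarrow> i \<le> k \<Longrightarrow> E k (act X k q \<alpha> x) i = E q x (\<alpha> i)"
    using assms by (simp add: nerve_iso_def simplicial_map_def act_nerve compose_def)
qed

lemma nerve_iso_inj:
  assumes "nerve_iso X E P" "x \<in> cells X q" "y \<in> cells X q" "\<And>i. i \<le> q \<Longrightarrow> E q x i = E q y i"
  shows "x = y"
proof -
  have "E q x = E q y"
    using nerve_isoD(1)[OF assms(1,2)] nerve_isoD(1)[OF assms(1,3)] assms(4)
    by (intro extensionalityI[of _ "{..q}"]) (auto simp: cells_nerve PiE_iff)
  then show ?thesis
    using assms(1-3) unfolding nerve_iso_def bij_betw_def inj_on_def by blast
qed

lemma nerve_iso_surj: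
  assumes "nerve_iso X E P" "\<And>i. i \<le> q \<Longrightarrow> c i \<in> P" "\<And>i j. \<lbrakk>i \<le> j; j \<le> q\<rbrakk> \<Longrightarrow> c i \<le> c j"
  obtains x where "x \<in> cells X q" "\<And>i. i \<le> q \<Longrightarrow> E q x i = c i"
proof -
  have "restrict c {..q} \<in> cells (nerve P) q"
    using assms by (auto simp: cells_nerve monotone_on_def)
  then obtain x where "x \<in> cells X q" "E q x = restrict c {..q}"
    using assms(1) unfolding nerve_iso_def bij_betw_def by (metis image_iff)
  then show thesis using that by simp
qed

lemma nerve_isoI:
  assumes "\<And>q x. x \<in> cells X q \<Longrightarrow> E q x \<in> extensional {..q}"
    "\<And>q x i. \<lbrakk>x \<in> cells X q; i \<le> q\<rbrakk> \<Longrightarrow> E q x i \<in> P"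
    "\<And>q x i j. \<lbrakk>x \<in> cells X q; i \<le> j; j \<le> q\<rbrakk> \<Longrightarrow> E q x i \<le> E q x j"
    "\<And>k q \<alpha> x i. \<lbrakk>x \<in> cells X q; \<alpha> \<in> opers k q; i \<le> k\<rbrakk> \<Longrightarrow> E k (act X k q \<alpha> x) i = E q x (\<alpha> i)"
    "\<And>q x y. \<lbrakk>x \<in> cells X q; y \<in> cells X q; \<And>i. i \<le> q \<Longrightarrow> E q x i = E q y i\<rbrakk> \<Longrightarrow> x = y"
    "\<And>q c. \<lbrakk>\<And>i. i \<le> q \<Longrightarrow> c i \<in> P; \<And>i j. \<lbrakk>i \<le> j; j \<le> q\<rbrakk> \<Longrightarrow> c i \<le> c j\<rbrakk> \<Longrightarrow> \<exists>x\<in>cells X q. \<forall>i\<le>q. E q x i = c i"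
    "simplicial_set X"
  shows "nerve_iso X E P"
proof -
  have cell: "E q x \<in> cells (nerve P) q" if "x \<in> cells X q" for q x
    using assms(1-3) that by (auto simp: cells_nerve PiE_iff monotone_on_def)
  have "E k (act X k q \<alpha> x) = act (nerve P) k q \<alpha> (E q x)" if "\<alpha> \<in> opers k q" "x \<in> cells X q" for k q \<alpha> x
    using assms(1)[OF simplicial_set.act_closed[OF assms(7) that]] assms(4)[OF that(2,1)]
    by (intro extensionalityI[of _ "{..k}"]) (auto simp: act_nerve compose_def)
  moreover have "inj_on (E q) (cells X q)" for q
    using assms(5) by (auto intro!: inj_onI)
  moreover have "cells (nerve P) q \<subseteq> E q ` cells X q" for q
  proof
    fix c assume c: "c \<in> cells (nerve P) q"
    then obtain x where x: "x \<in> cells X q" "\<forall>i\<le>q. E q x i = c i"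
      using assms(6)[of q c] by (auto simp: cells_nerve PiE_iff monotone_on_def)
    then have "E q x = c"
      using c assms(1)[OF x(1)] by (intro extensionalityI[of _ "{..q}"]) (auto simp: cells_nerve PiE_iff)
    then show "c \<in> E q ` cells X q" using x by blast
  qed
  moreover have "E q ` cells X q \<subseteq> cells (nerve P) q" for q
    using cell by blast
  ultimately show ?thesis
    using cell unfolding nerve_iso_def simplicial_map_def bij_betw_def by (simp add: subset_antisym)
qed

lemma nerve_iso_Delta: "nerve_iso (Delta n) (\<lambda>q x. x) {..n}"
  by (simp add: nerve_iso_def Delta_eq_nerve simplicial_map_def bij_betw_def)

text \<open>The pairing \<open>pr\<close> is abstract because it has two uses: as the pair of two
  numbers and as the disjoint sum of two sets. The second use makes the codomain of \<kappa> again a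
  nerve of sets ordered by inclusion, so that height functions exist there too.\<close>

lemma nerve_iso_prod:
  assumes X: "simplicial_set X" "nerve_iso X E P" and Y: "simplicial_set Y" "nerve_iso Y F Q"
    and pair: "\<And>a b c d. \<lbrakk>a \<in> P; b \<in> Q; c \<in> P; d \<in> Q\<rbrakk> \<Longrightarrow> pr a b \<le> pr c d \<longleftrightarrow> a \<le> c \<and> b \<le> d"
  shows "nerve_iso (X \<times>\<^sub>s Y) (\<lambda>q z. \<lambda>l\<in>{..q}. pr (E q (fst z) l) (F q (snd z) l))
           {pr a b | a b. a \<in> P \<and> b \<in> Q}"
    (is "nerve_iso _ ?G ?R")
proof (rule nerve_isoI)
  have pair_eq: "a = c \<and> b = d" if "pr a b = pr c d" "a \<in> P" "b \<in> Q" "c \<in> P" "d \<in> Q" for a b c d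
    using that pair[of a b c d] pair[of c d a b] by (auto intro: antisym)
  fix q :: nat
  { fix z assume "z \<in> cells (X \<times>\<^sub>s Y) q"
    then have z: "fst z \<in> cells X q" "snd z \<in> cells Y q" by (auto simp: sset_prod_def)
    show "?G q z \<in> extensional {..q}" by auto
    show "?G q z i \<in> ?R" if "i \<le> q" for i
      using that z X(2) Y(2) by (auto intro: nerve_isoD(2))
    show "?G q z i \<le> ?G q z j" if "i \<le> j" "j \<le> q" for i j
      using that z X(2) Y(2) by (auto simp: pair nerve_isoD(2,3))
    show "?G k (act (X \<times>\<^sub>s Y) k q \<alpha> z) i = ?G q z (\<alpha> i)" if "\<alpha> \<in> opers k q" "i \<le> k" for k \<alpha> i
      using that z X(2) Y(2) opers_le[OF that]
      by (auto simp: nerve_isoD(4) sset_prod_def)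
    fix w assume "w \<in> cells (X \<times>\<^sub>s Y) q" and eq: "\<And>i. i \<le> q \<Longrightarrow> ?G q z i = ?G q w i"
    then have w: "fst w \<in> cells X q" "snd w \<in> cells Y q" by (auto simp: sset_prod_def)
    have "E q (fst z) i = E q (fst w) i \<and> F q (snd z) i = F q (snd w) i" if "i \<le> q" for i
      using eq[OF that] that nerve_isoD(2)[OF X(2)] nerve_isoD(2)[OF Y(2)] z w
      by (intro pair_eq) auto
    then show "z = w"
      using nerve_iso_inj[OF X(2) z(1) w(1)] nerve_iso_inj[OF Y(2) z(2) w(2)]
      by (auto intro: prod_eqI) }
  fix c assume c: "\<And>i. i \<le> q \<Longrightarrow> c i \<in> ?R" and mono: "\<And>i j. \<lbrakk>i \<le> j; j \<le> q\<rbrakk> \<Longrightarrow> c i \<le> c j"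
  have "\<forall>i. \<exists>a b. i \<le> q \<longrightarrow> a \<in> P \<and> b \<in> Q \<and> c i = pr a b"
    using c by blast
  then obtain a b where ab: "\<And>i. i \<le> q \<Longrightarrow> a i \<in> P \<and> b i \<in> Q \<and> c i = pr (a i) (b i)"
    by metis
  have le: "a i \<le> a j \<and> b i \<le> b j" if "i \<le> j" "j \<le> q" for i j
  proof -
    have "i \<le> q" using that by (rule le_trans)
    then have "pr (a i) (b i) \<le> pr (a j) (b j)"
      using mono[OF that] ab[of i] ab[of j] that by simp
    then show ?thesis
      using ab[of i] ab[of j] that pair[of "a i" "b i" "a j" "b j"] by auto
  qed
  obtain x where x: "x \<in> cells X q" "\<And>i. i \<le> q \<Longrightarrow> E q x i = a i"
    by (rule nerve_iso_surj[OF X(2), of q a]) (use ab le in blast)+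
  obtain y where y: "y \<in> cells Y q" "\<And>i. i \<le> q \<Longrightarrow> F q y i = b i"
    by (rule nerve_iso_surj[OF Y(2), of q b]) (use ab le in blast)+
  show "\<exists>z\<in>cells (X \<times>\<^sub>s Y) q. \<forall>i\<le>q. ?G q z i = c i"
    using x y ab by (intro bexI[of _ "(x, y)"]) (auto simp: sset_prod_def)
next
  show "simplicial_set (X \<times>\<^sub>s Y)" using X(1) Y(1) by (rule simplicial_set_prod)
qed

section \<open>Subdivision of a nerve: labels and normal forms\<close>

definition chain_sets :: "'v::order set \<Rightarrow> 'v set set" where
  "chain_sets P = {S. finite S \<and> S \<noteq> {} \<and> S \<subseteq> P \<and> (\<forall>x\<in>S. \<forall>y\<in>S. x \<le> y \<or> y \<le> x)}"

lemma chain_enumeration: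
  fixes T :: "'v::order set"
  assumes "finite T" "T \<noteq> {}" "\<forall>x\<in>T. \<forall>y\<in>T. x \<le> y \<or> y \<le> x"
  obtains p and e :: "nat \<Rightarrow> 'v" where "e ` {..p} = T" "strict_mono_on {..p} e"
  using assms
proof (induction "card T" arbitrary: T thesis rule: less_induct)
  case less
  obtain t where t: "t \<in> T" "\<And>x. x \<in> T \<Longrightarrow> t \<le> x \<Longrightarrow> x = t"
    using finite_has_maximal[OF less.prems(2,3)] by metis
  show ?case
  proof (cases "T = {t}")
    case True
    then show ?thesis
      by (intro less.prems(1)[of "\<lambda>_. t" 0]) (auto simp: strict_mono_on_def)
  next
    case False
    have "card (T - {t}) < card T"
      using less.prems t by (intro psubset_card_mono) auto
    moreover have "T - {t} \<noteq> {}" using False less.prems(3) by blast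
    ultimately obtain e :: "nat \<Rightarrow> 'v" and p where e: "e ` {..p} = T - {t}" "strict_mono_on {..p} e"
      using less.hyps[of "T - {t}"] less.prems(2,4) by blast
    have lt: "e i < t" if "i \<le> p" for i
    proof -
      have "e i \<in> T" "e i \<noteq> t" using e that by auto
      then show ?thesis using t less.prems(4) by (metis order_less_le)
    qed
    show ?thesis
    proof (rule less.prems(1))
      show "(e(Suc p := t)) ` {..Suc p} = T"
      proof -
        have "(e(Suc p := t)) ` {..p} = e ` {..p}" by (rule image_cong) auto
        then have "(e(Suc p := t)) ` {..Suc p} = insert t (T - {t})"
          using e(1) unfolding atMost_Suc image_insert by simp
        then show ?thesis using t by auto
      qed
      show "strict_mono_on {..Suc p} (e(Suc p := t))"
        using lt e by (auto simp: strict_mono_on_def le_Suc_eq)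
    qed
  qed
qed

lemma strict_mono_on_le_iff:
  fixes e :: "nat \<Rightarrow> 'v::order"
  assumes "strict_mono_on {..p} e" "i \<le> p" "j \<le> p"
  shows "e i \<le> e j \<longleftrightarrow> i \<le> j"
proof
  assume "e i \<le> e j"
  then show "i \<le> j"
    using strict_mono_onD[OF assms(1), of j i] assms by (auto simp: not_less[symmetric])
next
  assume "i \<le> j"
  then show "e i \<le> e j"
    using strict_mono_onD[OF assms(1), of i j] assms by (cases "i = j") auto
qed

text \<open>Listing \<open>T\<close> in increasing order gives a simplex without repeated vertices,
  chosen without reference to a representative of any class. It is the common ground on which
  representatives with equal labels are compared.\<close>

lemma nerve_iso_enumeration:
  fixes P :: "'v::order set"
  assumes X: "nerve_iso X E P" and T: "T \<in> chain_sets P"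
  obtains p y where "y \<in> cells X p" "E p y ` {..p} = T" "strict_mono_on {..p} (E p y)"
proof -
  have fin: "finite T" and "T \<noteq> {}" "T \<subseteq> P" and tot: "\<forall>x\<in>T. \<forall>y\<in>T. x \<le> y \<or> y \<le> x"
    using T by (simp_all add: chain_sets_def)
  from fin \<open>T \<noteq> {}\<close> tot obtain p and e :: "nat \<Rightarrow> 'v" where e: "e ` {..p} = T" "strict_mono_on {..p} e"
    by (rule chain_enumeration)
  then have "e i \<in> P" if "i \<le> p" for i using \<open>T \<subseteq> P\<close> that by blast
  obtain y where y: "y \<in> cells X p" "\<And>i. i \<le> p \<Longrightarrow> E p y i = e i"
    by (rule nerve_iso_surj[OF X, of p e]) (use strict_mono_on_le_iff[OF e(2)] \<open>\<And>i. i \<le> p \<Longrightarrow> e i \<in> P\<close> in auto)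
  show thesis
    using y e by (intro that[of y p]) (auto simp: strict_mono_on_def)
qed

lemma cells_nerve_faces:
  assumes "c \<in> cells (nerve (faces n)) q" "l \<le> q"
  shows "c l \<subseteq> {..n}" "c l \<noteq> {}" "l \<le> l' \<Longrightarrow> l' \<le> q \<Longrightarrow> c l \<subseteq> c l'"
proof -
  have c: "\<forall>l\<le>q. c l \<in> faces n" and mono: "mono_on {..q} c"
    using assms(1) by (simp_all add: cells_nerve PiE_iff)
  show "c l \<subseteq> {..n}" "c l \<noteq> {}"
    using c assms(2) unfolding faces_def by blast+
  show "c l \<subseteq> c l'" if "l \<le> l'" "l' \<le> q"
    using mono_onD[OF mono, of l l'] that assms(2) by simp
qed

lemma cells_nerve_facesI:
  assumes "\<And>l. l \<le> q \<Longrightarrow> c l \<subseteq> {..n}" "\<And>l. l \<le> q \<Longrightarrow> c l \<noteq> {}"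
    "\<And>l l'. \<lbrakk>l \<le> l'; l' \<le> q\<rbrakk> \<Longrightarrow> c l \<subseteq> c l'"
  shows "restrict c {..q} \<in> cells (nerve (faces n)) q"
proof -
  have "restrict c {..q} \<in> {..q} \<rightarrow>\<^sub>E faces n"
    using assms(1,2) unfolding faces_def by (intro restrict_PiE_iff[THEN iffD2]) blast
  moreover have "mono_on {..q} (restrict c {..q})"
    using assms(3) by (intro mono_onI) simp
  ultimately show ?thesis by (simp add: cells_nerve)
qed

text \<open>A face of the simplex \<open>x\<close> is replaced by the set of its vertices in the
  poset. When \<open>x\<close> is degenerate, several vertices of a face may coincide there; the set
  forgets the repetition, as the gluing does.\<close>

definition Sd_label ::
    "(nat \<Rightarrow> 'a \<Rightarrow> nat \<Rightarrow> 'v) \<Rightarrow> nat \<Rightarrow> (nat \<times> 'a \<times> (nat \<Rightarrow> nat set)) set \<Rightarrow> nat \<Rightarrow> 'v set" where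
  "Sd_label E q = coend_lift (\<lambda>(n, x, c). \<lambda>l\<in>{..q}. E n x ` c l)"

lemma Sd_label_class:
  assumes X: "nerve_iso X E P"
  shows "Sd_label E q (Sd_class X q (n, x, c)) = (\<lambda>l\<in>{..q}. E n x ` c l)"
  unfolding Sd_label_def
proof (subst coend_lift_class, simp_all)
  fix n p \<alpha> x u
  assume a: "\<alpha> \<in> opers n p" "x \<in> cells X p" "u \<in> cells (nerve (faces n)) q"
  have "E n (act X n p \<alpha> x) ` u l = E p x ` nerve_map ((`) \<alpha>) q u l" if "l \<le> q" for l
  proof -
    have "u l \<subseteq> {..n}" using a(3) that by (auto simp: cells_nerve PiE_iff faces_def)
    then show ?thesis
      using nerve_isoD(4)[OF X a(2,1)] that
      by (auto simp: nerve_map_def compose_def image_image intro!: image_cong)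
  qed
  then show "(\<lambda>l\<in>{..q}. E n (act X n p \<alpha> x) ` u l) = (\<lambda>l\<in>{..q}. E p x ` nerve_map ((`) \<alpha>) q u l)"
    by (intro restrict_ext) simp
qed

text \<open>Restricting along the inclusion of the largest face of \<open>c\<close> and then factoring through the
  non-degenerate simplex \<open>y\<close> brings every representative into a normal form determined by its
  label.\<close>

lemma Sd_class_normal_form:
  assumes X: "nerve_iso X E P" and sX: "simplicial_set X"
    and x: "x \<in> cells X k" and c: "c \<in> cells (nerve (faces k)) q"
    and y: "y \<in> cells X p" "E p y ` {..p} = E k x ` c q" "strict_mono_on {..p} (E p y)"
  shows "Sd_class X q (k, x, c) = Sd_class X q (p, y, \<lambda>l\<in>{..q}. {j. j \<le> p \<and> E p y j \<in> E k x ` c l})"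
proof -
  have cq: "c q \<subseteq> {..k}" "c q \<noteq> {}" and cl: "\<And>l. l \<le> q \<Longrightarrow> c l \<subseteq> c q \<and> c l \<noteq> {}"
    and cmono: "\<And>l l'. l \<le> l' \<Longrightarrow> l' \<le> q \<Longrightarrow> c l \<subseteq> c l'"
    using c by (auto simp: cells_nerve PiE_iff faces_def monotone_on_def)
  have "finite (c q)" using cq by (auto intro: finite_subset)
  then obtain r and \<iota>0 :: "nat \<Rightarrow> nat" where \<iota>0: "\<iota>0 ` {..r} = c q" "strict_mono_on {..r} \<iota>0"
    by (rule chain_enumeration) (use cq in auto)
  define \<iota> where "\<iota> = restrict \<iota>0 {..r}"
  have \<iota>: "\<iota> ` {..r} = c q" "\<And>i j. \<lbrakk>i \<le> r; j \<le> r\<rbrakk> \<Longrightarrow> \<iota> i \<le> \<iota> j \<longleftrightarrow> i \<le> j"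
    using \<iota>0 strict_mono_on_le_iff[OF \<iota>0(2)] by (simp_all add: \<iota>_def)
  have \<iota>_op: "\<iota> \<in> opers r k"
    using \<iota> cq by (auto simp: opers_def monotone_on_def \<iota>_def)
  define c' where "c' = (\<lambda>l\<in>{..q}. {i. i \<le> r \<and> \<iota> i \<in> c l})"
  have img: "\<iota> ` {i. i \<le> r \<and> \<iota> i \<in> c l} = c l" if "l \<le> q" for l
    using cl[OF that] \<iota>(1) by (auto simp: image_iff)
  have c': "c' \<in> cells (nerve (faces r)) q"
    unfolding c'_def
  proof (rule cells_nerve_facesI)
    show "{i. i \<le> r \<and> \<iota> i \<in> c l} \<noteq> {}" if "l \<le> q" for l
      using img[OF that] cl[OF that] by blast
    show "{i. i \<le> r \<and> \<iota> i \<in> c l} \<subseteq> {i. i \<le> r \<and> \<iota> i \<in> c l'}" if "l \<le> l'" "l' \<le> q" for l l'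
      using cmono[OF that] by blast
  qed auto
  have "nerve_map ((`) \<iota>) q c' = c"
    using img c by (intro extensionalityI[of _ "{..q}"]) (auto simp: nerve_map_def compose_def c'_def cells_nerve PiE_iff)
  then have 1: "Sd_class X q (k, x, c) = Sd_class X q (r, act X r k \<iota> x, c')"
    using coend_class_eqI[where F="\<lambda>n. cells (nerve (faces n)) q" and G="\<lambda>n p \<alpha>. nerve_map ((`) \<alpha>) q",
        OF \<iota>_op x c'] by simp
  have "\<forall>i. \<exists>j. i \<le> r \<longrightarrow> j \<le> p \<and> E p y j = E k x (\<iota> i)"
  proof (intro allI)
    fix i
    have "E k x (\<iota> i) \<in> E p y ` {..p}" if "i \<le> r"
      using y(2) \<iota>(1) that by blast
    then show "\<exists>j. i \<le> r \<longrightarrow> j \<le> p \<and> E p y j = E k x (\<iota> i)" by (metis atMost_iff imageE)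
  qed
  then obtain \<sigma>0 where \<sigma>0: "\<And>i. i \<le> r \<Longrightarrow> \<sigma>0 i \<le> p \<and> E p y (\<sigma>0 i) = E k x (\<iota> i)" by metis
  define \<sigma> where "\<sigma> = restrict \<sigma>0 {..r}"
  have \<sigma>: "\<sigma> i \<le> p" "E p y (\<sigma> i) = E k x (\<iota> i)" if "i \<le> r" for i
    using \<sigma>0[OF that] that by (auto simp: \<sigma>_def)
  have "\<sigma> i \<le> \<sigma> j" if "i \<le> j" "j \<le> r" for i j
  proof -
    have "E k x (\<iota> i) \<le> E k x (\<iota> j)"
      using that \<iota> opers_le[OF \<iota>_op] by (intro nerve_isoD(3)[OF X x]) auto
    then show ?thesis
      using strict_mono_on_le_iff[OF y(3), of "\<sigma> i" "\<sigma> j"] \<sigma> that by simp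
  qed
  then have \<sigma>_op: "\<sigma> \<in> opers r p"
    using \<sigma> by (auto simp: opers_def monotone_on_def \<sigma>_def)
  have "act X r k \<iota> x = act X r p \<sigma> y"
    by (rule nerve_iso_inj[OF X, of _ r])
      (use sX \<iota>_op \<sigma>_op x y \<sigma> in \<open>simp_all add: simplicial_set.act_closed nerve_isoD(4)[OF X]\<close>)
  then have 2: "Sd_class X q (r, act X r k \<iota> x, c') = Sd_class X q (p, y, nerve_map ((`) \<sigma>) q c')"
    using coend_class_eqI[where F="\<lambda>n. cells (nerve (faces n)) q" and G="\<lambda>n p \<alpha>. nerve_map ((`) \<alpha>) q",
        OF \<sigma>_op y(1) c'] by simp
  have "\<sigma> ` {i. i \<le> r \<and> \<iota> i \<in> c l} = {j. j \<le> p \<and> E p y j \<in> E k x ` c l}" if l: "l \<le> q" for l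
  proof (intro equalityI subsetI)
    fix j assume "j \<in> {j. j \<le> p \<and> E p y j \<in> E k x ` c l}"
    then obtain v where v: "j \<le> p" "v \<in> c l" "E p y j = E k x v" by auto
    then obtain i where i: "i \<le> r" "\<iota> i = v" using img[OF l] by (metis (mono_tags, lifting) imageE mem_Collect_eq)
    then have "E p y (\<sigma> i) = E p y j" using \<sigma> v by simp
    then have "\<sigma> i = j"
      using strict_mono_on_le_iff[OF y(3), of "\<sigma> i" j] strict_mono_on_le_iff[OF y(3), of j "\<sigma> i"] \<sigma> i v
      by (simp add: antisym)
    then show "j \<in> \<sigma> ` {i. i \<le> r \<and> \<iota> i \<in> c l}" using i v by auto
  qed (use \<sigma> in auto)
  then have "nerve_map ((`) \<sigma>) q c' = (\<lambda>l\<in>{..q}. {j. j \<le> p \<and> E p y j \<in> E k x ` c l})"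
    unfolding nerve_map_def compose_def c'_def by (intro restrict_ext) simp
  with 1 2 show ?thesis by simp
qed

lemma Sd_cellE:
  assumes "z \<in> cells (Sd X) q"
  obtains n x c where "z = Sd_class X q (n, x, c)" "x \<in> cells X n" "c \<in> cells (nerve (faces n)) q"
  using assms unfolding cells_Sd by blast

text \<open>The simplex enumerating the largest label serves twice. Two classes with equal labels
  have the same normal form over it, and an increasing sequence of chains pulls back along it to a
  class with these labels.\<close>

lemma nerve_iso_Sd:
  assumes X: "nerve_iso X E P" and sX: "simplicial_set X"
  shows "nerve_iso (Sd X) (Sd_label E) (chain_sets P)"
proof (rule nerve_isoI)
  note lab = Sd_label_class[OF X]
  show "simplicial_set (Sd X)" by (rule simplicial_set_Sd)
  have chain: "E n x ` S \<in> chain_sets P" if "x \<in> cells X n" "S \<subseteq> {..n}" "S \<noteq> {}" for n x S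
  proof -
    have "finite S" using that(2) finite_subset by blast
    moreover have "E n x i \<le> E n x j \<or> E n x j \<le> E n x i" if "i \<in> S" "j \<in> S" for i j
      using nerve_isoD(3)[OF X \<open>x \<in> cells X n\<close>] that \<open>S \<subseteq> {..n}\<close> by (metis atMost_iff nat_le_linear subsetD)
    ultimately show ?thesis
      using nerve_isoD(2)[OF X that(1)] that by (auto simp: chain_sets_def)
  qed
  fix q :: nat
  { fix z assume "z \<in> cells (Sd X) q"
    then obtain n x c where z: "z = Sd_class X q (n, x, c)" "x \<in> cells X n" "c \<in> cells (nerve (faces n)) q"
      by (rule Sd_cellE)
    note c = cells_nerve_faces[OF z(3)]
    show "Sd_label E q z \<in> extensional {..q}" by (simp add: z lab)
    show "Sd_label E q z l \<in> chain_sets P" if "l \<le> q" for l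
      using that chain[OF z(2)] c by (simp add: z lab)
    show "Sd_label E q z l \<le> Sd_label E q z l'" if "l \<le> l'" "l' \<le> q" for l l'
      using that c(3)[of l l'] by (auto simp: z lab)
    show "Sd_label E k (act (Sd X) k q \<alpha> z) l = Sd_label E q z (\<alpha> l)" if "\<alpha> \<in> opers k q" "l \<le> k" for k \<alpha> l
      using that opers_le[OF that] by (simp add: z lab act_Sd_class act_nerve compose_def)
    fix w assume "w \<in> cells (Sd X) q" and eq: "\<And>l. l \<le> q \<Longrightarrow> Sd_label E q z l = Sd_label E q w l"
    then obtain n' x' c' where w: "w = Sd_class X q (n', x', c')" "x' \<in> cells X n'" "c' \<in> cells (nerve (faces n')) q"
      by (metis Sd_cellE)
    have eq': "E n x ` c l = E n' x' ` c' l" if "l \<le> q" for l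
      using eq[OF that] that by (simp add: z w lab)
    obtain p y where y: "y \<in> cells X p" "E p y ` {..p} = E n x ` c q" "strict_mono_on {..p} (E p y)"
      using nerve_iso_enumeration[OF X chain[OF z(2) c(1)[OF order_refl] c(2)[OF order_refl]]] by blast
    have "(\<lambda>l\<in>{..q}. {j. j \<le> p \<and> E p y j \<in> E n x ` c l}) = (\<lambda>l\<in>{..q}. {j. j \<le> p \<and> E p y j \<in> E n' x' ` c' l})"
      using eq' by (auto simp: fun_eq_iff restrict_def)
    then show "z = w"
      using Sd_class_normal_form[OF X sX z(2,3) y] Sd_class_normal_form[OF X sX w(2,3) y(1) _ y(3)]
        y(2) eq'[of q] z w by simp }
  fix D assume D: "\<And>l. l \<le> q \<Longrightarrow> D l \<in> chain_sets P" and mono: "\<And>l l'. \<lbrakk>l \<le> l'; l' \<le> q\<rbrakk> \<Longrightarrow> D l \<subseteq> D l'"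
  obtain p y where y: "y \<in> cells X p" "E p y ` {..p} = D q" "strict_mono_on {..p} (E p y)"
    using nerve_iso_enumeration[OF X D[OF le_refl]] by blast
  define c where "c = (\<lambda>l\<in>{..q}. {j. j \<le> p \<and> E p y j \<in> D l})"
  have img: "E p y ` {j. j \<le> p \<and> E p y j \<in> D l} = D l" if "l \<le> q" for l
    using mono[OF that order_refl] y(2) by (auto simp: image_iff)
  have ne: "D l \<noteq> {}" if "l \<le> q" for l
    using D[OF that] by (auto simp: chain_sets_def)
  have "c \<in> cells (nerve (faces p)) q"
    unfolding c_def
  proof (rule cells_nerve_facesI)
    show "{j. j \<le> p \<and> E p y j \<in> D l} \<noteq> {}" if "l \<le> q" for l
      using img[OF that] ne[OF that] by blast
    show "{j. j \<le> p \<and> E p y j \<in> D l} \<subseteq> {j. j \<le> p \<and> E p y j \<in> D l'}" if "l \<le> l'" "l' \<le> q" for l l'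
      using mono[OF that] by blast
  qed auto
  then have "Sd_class X q (p, y, c) \<in> cells (Sd X) q"
    using y(1) unfolding cells_Sd by blast
  moreover have "\<forall>l\<le>q. Sd_label E q (Sd_class X q (p, y, c)) l = D l"
    using img by (simp add: lab c_def)
  ultimately show "\<exists>z\<in>cells (Sd X) q. \<forall>l\<le>q. Sd_label E q z l = D l"
    by (rule bexI[rotated])
qed

lemma finite_chain_sets:
  assumes "finite P" shows "finite (chain_sets P)"
proof (rule finite_subset)
  show "chain_sets P \<subseteq> Pow P" unfolding chain_sets_def by blast
  show "finite (Pow P)" using assms by simp
qed

text \<open>\<open>\<delta>\<close> omits the index \<open>Suc l\<close> and \<open>\<sigma>\<close>
  takes the value \<open>l\<close> twice: a repeated vertex can be removed and put back. Finiteness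
  and the passage to reduced representatives both rest on this.\<close>

lemma collapse_step:
  assumes X: "nerve_iso X E P" and sX: "simplicial_set X" and x: "x \<in> cells X (Suc k)" and l: "l \<le> k"
    and eq: "E (Suc k) x l = E (Suc k) x (Suc l)"
  obtains \<sigma> y where "\<sigma> \<in> opers (Suc k) k" "\<sigma> ` {..Suc k} = {..k}" "y \<in> cells X k"
    "x = act X (Suc k) k \<sigma> y"
proof -
  define \<delta> where "\<delta> i = (if i \<le> l then i else Suc i)" for i
  define \<sigma> where "\<sigma> = (\<lambda>i\<in>{..Suc k}. if i \<le> l then i else i - 1)"
  have \<sigma>: "\<sigma> \<in> opers (Suc k) k"
    using l by (auto simp: \<sigma>_def opers_def monotone_on_def)
  have onto: "\<sigma> ` {..Suc k} = {..k}"
  proof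
    show "{..k} \<subseteq> \<sigma> ` {..Suc k}"
    proof
      fix i assume "i \<in> {..k}"
      then have "\<sigma> (\<delta> i) = i" "\<delta> i \<le> Suc k" by (auto simp: \<sigma>_def \<delta>_def)
      then show "i \<in> \<sigma> ` {..Suc k}" by (metis atMost_iff imageI)
    qed
  qed (use opers_le[OF \<sigma>] in auto)
  obtain y where y: "y \<in> cells X k" "\<And>i. i \<le> k \<Longrightarrow> E k y i = E (Suc k) x (\<delta> i)"
    using nerve_iso_surj[OF X, of k "\<lambda>i. E (Suc k) x (\<delta> i)"] nerve_isoD(2,3)[OF X x]
    by (auto simp: \<delta>_def)
  have "x = act X (Suc k) k \<sigma> y"
  proof (rule nerve_iso_inj[OF X x])
    show "act X (Suc k) k \<sigma> y \<in> cells X (Suc k)"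
      using simplicial_set.act_closed[OF sX \<sigma> y(1)] .
    fix i assume i: "i \<le> Suc k"
    have "E (Suc k) (act X (Suc k) k \<sigma> y) i = E (Suc k) x (\<delta> (\<sigma> i))"
      using i opers_le[OF \<sigma> i] y by (simp add: nerve_isoD(4)[OF X y(1) \<sigma>])
    also have "\<dots> = E (Suc k) x i"
    \<comment> \<open>\<open>Suc l\<close> is the only index moved by \<open>\<delta>\<close> after
      \<open>\<sigma>\<close>; it goes to \<open>l\<close>, which carries the same label.\<close>
    proof (cases "i = Suc l")
      case True then show ?thesis using eq i by (simp add: \<sigma>_def \<delta>_def)
    next
      case False
      then have "\<delta> (\<sigma> i) = i" using i by (auto simp: \<sigma>_def \<delta>_def)
      then show ?thesis by simp
    qed
    finally show "E (Suc k) x i = E (Suc k) (act X (Suc k) k \<sigma> y) i" by simp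
  qed
  then show thesis using that \<sigma> onto y by blast
qed

section \<open>Realizations of nerves of posets of sets\<close>

lemma finite_cells_nerve_iso:
  assumes "nerve_iso X E P" "finite P"
  shows "finite (cells X q)"
proof -
  have "finite ({..q} \<rightarrow>\<^sub>E P)" using assms(2) by (simp add: finite_PiE)
  then have "finite (cells (nerve P) q)"
    unfolding cells_nerve by (rule finite_subset[rotated]) blast
  then show ?thesis
    using assms(1) bij_betw_finite unfolding nerve_iso_def by blast
qed

text \<open>By pigeonhole two of the \<open>q + 1\<close> labels agree; all labels between them are
  then squeezed, so two consecutive ones agree.\<close>

lemma label_repeats:
  assumes X: "nerve_iso X E P" and P: "finite P" and x: "x \<in> cells X q" and q: "card P \<le> q"
  obtains k l where "q = Suc k" "l \<le> k" "E q x l = E q x (Suc l)"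
proof -
  have "E q x ` {..q} \<subseteq> P" using nerve_isoD(2)[OF X x] by auto
  then have "card (E q x ` {..q}) \<le> card P" using P by (rule card_mono[rotated])
  then have "\<not> inj_on (E q x) {..q}"
    using card_image[of "E q x" "{..q}"] q by auto
  then obtain i j where ij: "i < j" "j \<le> q" "E q x i = E q x j"
    unfolding inj_on_def by (metis atMost_iff linorder_neqE_nat)
  have "E q x i \<le> E q x (Suc i)" "E q x (Suc i) \<le> E q x j"
    using ij nerve_isoD(3)[OF X x, of i "Suc i"] nerve_isoD(3)[OF X x, of "Suc i" j] by simp_all
  then have "E q x i = E q x (Suc i)" using ij(3) by simp
  then show thesis using that[of "q - 1" i] ij by simp
qed

lemma finite_sset_nerve_iso:
  assumes X: "nerve_iso X E P" and sX: "simplicial_set X" and P: "finite P"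
  shows "finite_sset X"
proof -
  have "degenerate X q x" if x: "x \<in> cells X q" and q: "card P \<le> q" for q x
  proof -
    obtain k l where kl: "q = Suc k" "l \<le> k" "E q x l = E q x (Suc l)"
      using label_repeats[OF X P x q] .
    obtain \<sigma> y where "\<sigma> \<in> opers (Suc k) k" "\<sigma> ` {..Suc k} = {..k}" "y \<in> cells X k"
      "x = act X (Suc k) k \<sigma> y"
      using collapse_step[OF X sX, of x k l] x kl by blast
    then show ?thesis unfolding degenerate_def kl(1) by blast
  qed
  then have "nondegenerate_simplices X \<subseteq> Sigma {..<card P} (cells X)"
    unfolding nondegenerate_simplices_def by (auto simp: not_le[symmetric])
  moreover have "finite (Sigma {..<card P} (cells X))"
    using finite_cells_nerve_iso[OF X P] by (intro finite_SigmaI) auto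
  ultimately show ?thesis
    using sX finite_subset unfolding finite_sset_def by blast
qed

section \<open>Decomposition of non-negative functions into layers\<close>

definition layers :: "nat \<Rightarrow> (nat \<Rightarrow> 'v set) \<Rightarrow> (nat \<Rightarrow> real) \<Rightarrow> 'v \<Rightarrow> real" where
  "layers q S t v = (\<Sum>l<q. if v \<in> S l then t l else 0)"

text \<open>Here \<open>q\<close> counts layers, so a simplex of dimension \<open>q\<close> has
  \<open>Suc q\<close> of them and inductions start from the empty sum. Layers grow with the
  index.\<close>

definition strict_flag :: "nat \<Rightarrow> (nat \<Rightarrow> 'v set) \<Rightarrow> (nat \<Rightarrow> real) \<Rightarrow> bool" where
  "strict_flag q S t \<longleftrightarrow> (\<forall>l<q. S l \<noteq> {} \<and> 0 < t l) \<and> (\<forall>l. Suc l < q \<longrightarrow> S l \<subset> S (Suc l))"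

lemma strict_flag_Suc: "strict_flag (Suc q) S t \<Longrightarrow> strict_flag q S t"
  by (simp add: strict_flag_def)

lemma strict_flag_mono:
  assumes "strict_flag q S t" "l \<le> l'" "l' < q" shows "S l \<subseteq> S l'"
  using assms(2,3)
proof (induction l' rule: dec_induct)
  case (step k)
  then show ?case using assms(1) unfolding strict_flag_def by (meson Suc_lessD order.trans psubset_imp_subset)
qed simp

text \<open>All layers lie in the last one and all weights are positive. Hence the last layer is the
  support and its weight is the least non-zero value; both can be read off the function, and
  uniqueness follows by peeling them off.\<close>

lemma layers_top:
  assumes S: "strict_flag (Suc q) S t"
  shows "v \<in> S q \<longleftrightarrow> layers (Suc q) S t v \<noteq> 0"
    "v \<in> S q \<Longrightarrow> t q \<le> layers (Suc q) S t v"
    "\<exists>v\<in>S q. layers (Suc q) S t v = t q"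
proof -
  have pos: "0 < t l" if "l < Suc q" for l using S that unfolding strict_flag_def by blast
  have nn: "0 \<le> layers q S t v" for v
    unfolding layers_def by (rule sum_nonneg) (use pos in \<open>simp add: less_imp_le\<close>)
  show ge: "t q \<le> layers (Suc q) S t v" if "v \<in> S q" for v
    using nn[of v] that by (simp add: layers_def)
  show "v \<in> S q \<longleftrightarrow> layers (Suc q) S t v \<noteq> 0"
  proof
    assume "v \<in> S q" then show "layers (Suc q) S t v \<noteq> 0" using ge pos[of q] by force
  next
    assume ne: "layers (Suc q) S t v \<noteq> 0"
    show "v \<in> S q"
    proof (rule ccontr)
      assume "v \<notin> S q"
      then have "v \<notin> S l" if "l < Suc q" for l
        using strict_flag_mono[OF S, of l q] that by auto
      then have "layers (Suc q) S t v = 0"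
        unfolding layers_def by (intro sum.neutral) simp
      then show False using ne by simp
    qed
  qed
  have "\<exists>v\<in>S q. \<forall>l<q. v \<notin> S l"
  proof (cases q)
    case 0 then show ?thesis using S by (auto simp: strict_flag_def)
  next
    case (Suc k)
    then obtain v where "v \<in> S q" "v \<notin> S k" using S unfolding strict_flag_def by blast
    then show ?thesis
      using strict_flag_mono[OF S, of _ k] Suc by (metis less_Suc_eq less_Suc_eq_le subsetD)
  qed
  then obtain v where "v \<in> S q" "\<forall>l<q. v \<notin> S l" by blast
  then have "layers (Suc q) S t v = t q" by (simp add: layers_def)
  then show "\<exists>v\<in>S q. layers (Suc q) S t v = t q" using \<open>v \<in> S q\<close> by blast
qed

lemma layers_unique:
  assumes "strict_flag q S t" "strict_flag q' S' t'" "layers q S t = layers q' S' t'"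
  shows "q = q' \<and> (\<forall>l<q. S l = S' l \<and> t l = t' l)"
  using assms
proof (induction q arbitrary: q')
  case 0
  have "q' = 0"
  proof (rule ccontr)
    assume "q' \<noteq> 0"
    then obtain r where r: "q' = Suc r" by (cases q') auto
    then obtain v where "v \<in> S' r" using 0(2) unfolding strict_flag_def by blast
    then have "layers (Suc r) S' t' v \<noteq> 0" using layers_top(1)[of r S' t' v] 0(2) r by simp
    then show False using fun_cong[OF 0(3), of v] r by (simp add: layers_def[of 0])
  qed
  then show ?case by simp
next
  case (Suc q)
  have "q' \<noteq> 0"
  proof
    assume [simp]: "q' = 0"
    obtain v where "v \<in> S q" using Suc.prems(1) unfolding strict_flag_def by blast
    then have "layers (Suc q) S t v \<noteq> 0" using layers_top(1)[OF Suc.prems(1)] by blast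
    then show False using Suc.prems(3) by (simp add: layers_def)
  qed
  then obtain r where r: "q' = Suc r" by (cases q') auto
  note top = layers_top[OF Suc.prems(1)] and top' = layers_top[OF Suc.prems(2)[unfolded r]]
  note eq = Suc.prems(3)[unfolded r]
  have S: "S q = S' r" using top(1) top'(1) eq by auto
  have t: "t q = t' r"
    using top(2,3) top'(2,3) S eq by (metis order_antisym)
  have "layers q S t v = layers r S' t' v" for v
    using fun_cong[OF eq, of v] S t by (cases "v \<in> S' r") (simp_all add: layers_def)
  then have "layers q S t = layers r S' t'" by (rule ext)
  from Suc.IH[OF strict_flag_Suc[OF Suc.prems(1)] strict_flag_Suc[OF Suc.prems(2)[unfolded r]] this]
  have IH: "q = r" "\<And>l. l < q \<Longrightarrow> S l = S' l \<and> t l = t' l" by blast+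
  have "S l = S' l \<and> t l = t' l" if "l < Suc q" for l
    using IH(2)[of l] S t IH(1) that by (cases "l = q") simp_all
  then show ?case using IH(1) r by blast
qed

text \<open>Subtracting the least non-zero value \<open>c\<close> on the support removes at least
  one point from the support, which drives the induction. The layers are recorded as superlevel sets
  because those are what the posets at hand can be tested on.\<close>

lemma layers_exist:
  fixes g :: "'v \<Rightarrow> real"
  assumes "finite {v. g v \<noteq> 0}" "{v. g v \<noteq> 0} \<noteq> {}" "\<And>v. 0 \<le> g v"
  obtains q S t where "strict_flag (Suc q) S t" "g = layers (Suc q) S t"
    "\<forall>l\<le>q. \<exists>s>0. S l = {v. s \<le> g v}"
  using assms
proof (induction "card {v. g v \<noteq> 0}" arbitrary: g thesis rule: less_induct)
  case less
  define X where "X = {v. g v \<noteq> 0}"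
  have X: "finite X" "X \<noteq> {}" using less.prems by (simp_all add: X_def)
  define c where "c = Min (g ` X)"
  have "c \<in> g ` X" unfolding c_def using X by (intro Min_in) auto
  then obtain w where w: "w \<in> X" "g w = c" by auto
  have c0: "0 < c" using w less.prems(4)[of w] by (auto simp: X_def order_less_le)
  have cle: "c \<le> g v" if "v \<in> X" for v unfolding c_def using X that by (intro Min_le) auto
  have X_eq: "X = {v. c \<le> g v}" using cle c0 by (force simp: X_def)
  define g' where "g' v = (if v \<in> X then g v - c else 0)" for v
  have supp: "{v. g' v \<noteq> 0} \<subseteq> X - {w}" using w by (auto simp: g'_def)
  show ?case
  proof (cases "{v. g' v \<noteq> 0} = {}")
    case True
    then have g'0: "g' v = 0" for v by blast
    have "g v = (if v \<in> X then c else 0)" for v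
      using g'0[of v] by (simp add: g'_def X_def split: if_splits)
    then have "g = layers (Suc 0) (\<lambda>_. X) (\<lambda>_. c)" by (auto simp: layers_def)
    moreover have "strict_flag (Suc 0) (\<lambda>_. X) (\<lambda>_. c)" using X c0 by (auto simp: strict_flag_def)
    ultimately show ?thesis using X_eq c0 by (intro less.prems(1)[of 0 "\<lambda>_. X" "\<lambda>_. c"]) auto
  next
    case False
    have fin: "finite {v. g' v \<noteq> 0}" using supp X finite_subset by blast
    have "card {v. g' v \<noteq> 0} < card {v. g v \<noteq> 0}"
      using supp w X unfolding X_def[symmetric] by (intro psubset_card_mono) auto
    moreover have "0 \<le> g' v" for v using cle by (auto simp: g'_def)
    ultimately obtain q S t where IH: "strict_flag (Suc q) S t" "g' = layers (Suc q) S t"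
      "\<forall>l\<le>q. \<exists>s>0. S l = {v. s \<le> g' v}"
      using less.hyps[of g'] False fin by blast
    let ?S = "S(Suc q := X)" and ?t = "t(Suc q := c)"
    have "S q = {v. g' v \<noteq> 0}" using layers_top(1)[OF IH(1)] IH(2) by auto
    then have "S q \<subset> X" using supp w by auto
    then have "strict_flag (Suc (Suc q)) ?S ?t"
      using IH(1) X c0 unfolding strict_flag_def by (auto simp: less_Suc_eq)
    moreover have "g = layers (Suc (Suc q)) ?S ?t"
    proof
      fix v
      have "layers (Suc (Suc q)) ?S ?t v = layers (Suc q) S t v + (if v \<in> X then c else 0)"
        unfolding layers_def sum.lessThan_Suc[of _ "Suc q"] by (intro arg_cong2[of _ _ _ _ "(+)"] sum.cong) auto
      also have "\<dots> = g' v + (if v \<in> X then c else 0)" using IH(2) by simp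
      also have "\<dots> = g v" by (simp add: g'_def X_def)
      finally show "g v = layers (Suc (Suc q)) ?S ?t v" by simp
    qed
    moreover have "\<exists>s>0. ?S l = {v. s \<le> g v}" if l: "l \<le> Suc q" for l
    proof (cases "l = Suc q")
      case True then show ?thesis using X_eq c0 by auto
    next
      case False
      then have "l \<le> q" using l by simp
      then obtain s where s: "s > 0" "S l = {v. s \<le> g' v}" using IH(3) by blast
      have "s \<le> g' v \<longleftrightarrow> s + c \<le> g v" for v using s c0 by (auto simp: g'_def X_def)
      then have "?S l = {v. s + c \<le> g v}" using s False by auto
      then show ?thesis using s(1) c0 by (metis add_pos_pos)
    qed
    ultimately show ?thesis using less.prems(1) by blast
  qed
qed

section \<open>The height function of a point of the realization\<close>

definition height :: "(nat \<Rightarrow> 'a \<Rightarrow> nat \<Rightarrow> 'v set) \<Rightarrow> (nat \<times> 'a \<times> (nat \<Rightarrow> real)) set \<Rightarrow> 'v \<Rightarrow> real" where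
  "height E = coend_lift (\<lambda>(q, z, t). layers (Suc q) (E q z) t)"

text \<open>\<open>affine_op\<close> pushes weights forward along \<open>\<alpha>\<close>, and this
  is the change of variables. With an indicator for \<open>f\<close> it makes heights well defined;
  with the constant 1 it shows that the total weight is kept.\<close>

lemma sum_affine_op:
  assumes "\<alpha> \<in> opers n p"
  shows "(\<Sum>j\<le>p. affine_op n p \<alpha> t j * f j) = (\<Sum>i\<le>n. t i * f (\<alpha> i))"
proof -
  have "(\<Sum>j\<le>p. affine_op n p \<alpha> t j * f j) = (\<Sum>j\<le>p. \<Sum>i\<in>{i \<in> {..n}. \<alpha> i = j}. t i * f (\<alpha> i))"
    unfolding affine_op_def sum_distrib_right by (intro sum.cong) auto
  also have "\<dots> = (\<Sum>i\<le>n. t i * f (\<alpha> i))"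
    using opers_le[OF assms] by (intro sum.group) auto
  finally show ?thesis .
qed

lemma height_class:
  assumes X: "nerve_iso X E P"
  shows "height E (rclass X (q, z, t)) = layers (Suc q) (E q z) t"
  unfolding height_def
proof (subst coend_lift_class, simp_all)
  fix n p \<alpha> x and u :: "nat \<Rightarrow> real"
  assume a: "\<alpha> \<in> opers n p" "x \<in> cells X p" "u \<in> standard_simplex n"
  have *: "layers (Suc q) S t v = (\<Sum>l\<le>q. t l * (if v \<in> S l then 1 else 0))" for q S t and v :: 'b
    unfolding layers_def lessThan_Suc_atMost by (intro sum.cong) auto
  show "layers (Suc n) (E n (act X n p \<alpha> x)) u = layers (Suc p) (E p x) (affine_op n p \<alpha> u)"
  proof
    fix v
    show "layers (Suc n) (E n (act X n p \<alpha> x)) u v = layers (Suc p) (E p x) (affine_op n p \<alpha> u) v"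
      unfolding * sum_affine_op[OF a(1)]
      by (intro sum.cong) (auto simp: nerve_isoD(4)[OF X a(2,1)])
  qed
qed

lemma coendE:
  assumes "a \<in> coend X standard_simplex affine_op"
  obtains q z t where "a = rclass X (q, z, t)" "z \<in> cells X q" "t \<in> standard_simplex q"
  using assms unfolding coend_def by blast

text \<open>In a representative of least dimension no weight vanishes, since that vertex could be
  omitted, and no two consecutive labels agree, since the simplex would be a degeneracy.\<close>

lemma reduced_representative:
  assumes X: "nerve_iso X E P" and sX: "simplicial_set X"
    and P: "\<And>S. S \<in> P \<Longrightarrow> S \<noteq> {}"
    and a: "a \<in> coend X standard_simplex affine_op"
  obtains q z t where "a = rclass X (q, z, t)" "z \<in> cells X q" "t \<in> standard_simplex q"
    "strict_flag (Suc q) (E q z) t"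
proof -
  define R where "R q \<longleftrightarrow> (\<exists>z t. a = rclass X (q, z, t) \<and> z \<in> cells X q \<and> t \<in> standard_simplex q)" for q
  have "\<exists>q. R q" using a unfolding R_def by (blast elim: coendE)
  then obtain q where "R q" and least: "\<And>k. k < q \<Longrightarrow> \<not> R k"
    using exists_least_iff[of R] by blast
  then obtain z t where z: "a = rclass X (q, z, t)" "z \<in> cells X q" and t: "t \<in> standard_simplex q"
    unfolding R_def by blast
  have t_nn: "0 \<le> t l" and t_gt: "q < l \<Longrightarrow> t l = 0" and t_sum: "(\<Sum>l\<le>q. t l) = 1" for l
    using t by (auto simp: standard_simplex_def)
  have pos: "0 < t l" if "l \<le> q" for l
  proof (rule ccontr)
    assume "\<not> 0 < t l"
    then have tl: "t l = 0" using t_nn[of l] by simp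
    have "q \<noteq> 0"
    proof
      assume "q = 0"
      then show False using that tl t_sum by simp
    qed
    then obtain k where q: "q = Suc k" by (cases q) auto
    \<comment> \<open>The face omitting the vertex \<open>l\<close> of weight 0; \<open>t'\<close>
      carries the remaining weights and pushes forward to \<open>t\<close>.\<close>
    define \<delta> where "\<delta> = (\<lambda>i\<in>{..k}. if i < l then i else Suc i)"
    define t' where "t' i = (if i \<le> k then t (\<delta> i) else 0)" for i
    have \<delta>: "\<delta> \<in> opers k q" by (auto simp: \<delta>_def opers_def monotone_on_def q)
    have aff: "affine_op k q \<delta> t' = t"
    proof
      fix j
      have *: "{i. i \<le> k \<and> \<delta> i = j} = (if j \<le> Suc k \<and> j \<noteq> l then {if j < l then j else j - 1} else {})"
        using that by (auto simp: \<delta>_def q)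
      show "affine_op k q \<delta> t' j = t j"
      proof (cases "j \<le> Suc k \<and> j \<noteq> l")
        case True
        then have "affine_op k q \<delta> t' j = t' (if j < l then j else j - 1)"
          unfolding affine_op_def * by simp
        then show ?thesis using True that by (auto simp: t'_def \<delta>_def q)
      next
        case False
        then have "affine_op k q \<delta> t' j = 0" unfolding affine_op_def * by auto
        then show ?thesis using False tl t_gt[of j] by (auto simp: q)
      qed
    qed
    have "(\<Sum>i\<le>k. t' i) = 1"
      using sum_affine_op[OF \<delta>, of t' "\<lambda>_. 1"] aff t_sum by simp
    then have t': "t' \<in> standard_simplex k"
      using t by (auto simp: standard_simplex_def t'_def)
    have "a = rclass X (k, act X k q \<delta> z, t')"
      using coend_class_eqI[where F=standard_simplex and G=affine_op, OF \<delta> z(2) t'] aff z(1) by simp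
    then have "R k"
      unfolding R_def using t' simplicial_set.act_closed[OF sX \<delta> z(2)] by blast
    then show False using least[of k] q by simp
  qed
  have "E q z l \<subset> E q z (Suc l)" if "l < q" for l
  proof (rule ccontr)
    assume neg: "\<not> E q z l \<subset> E q z (Suc l)"
    have "q \<noteq> 0" using that by simp
    then obtain k where q: "q = Suc k" by (cases q) auto
    have "E q z l \<subseteq> E q z (Suc l)"
      using nerve_isoD(3)[OF X z(2), of l "Suc l"] that by simp
    then have eq: "E (Suc k) z l = E (Suc k) z (Suc l)" using neg q by blast
    have "z \<in> cells X (Suc k)" "l \<le> k" using z(2) \<open>l < q\<close> q by simp_all
    from collapse_step[OF X sX this eq]
    obtain \<sigma> y where \<sigma>: "\<sigma> \<in> opers (Suc k) k" and y: "y \<in> cells X k" "z = act X (Suc k) k \<sigma> y" .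
    have "a = rclass X (k, y, affine_op q k \<sigma> t)"
      using coend_class_eqI[where F=standard_simplex and G=affine_op, OF \<sigma> y(1)] t z(1) y(2) q by simp
    then have "R k"
      unfolding R_def using y affine_op_standard_simplex[OF \<sigma>] t q by blast
    then show False using least[of k] q by simp
  qed
  moreover have "E q z l \<noteq> {}" if "l \<le> q" for l
    using P nerve_isoD(2)[OF X z(2) that] by blast
  ultimately have "strict_flag (Suc q) (E q z) t"
    using pos by (simp add: strict_flag_def less_Suc_eq_le)
  then show thesis using that z t by blast
qed

text \<open>An empty label would be invisible in the height function, so labels are non-empty.
  Finiteness of \<open>P\<close> bounds the dimension of reduced representatives, whence
  compactness.\<close>

locale set_nerve =
  fixes X :: "'a sset" and E :: "nat \<Rightarrow> 'a \<Rightarrow> nat \<Rightarrow> 'v set" and P :: "'v set set"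
  assumes sX: "simplicial_set X" and iso: "nerve_iso X E P"
    and finite_P: "finite P" and P_mem: "S \<in> P \<Longrightarrow> finite S \<and> S \<noteq> {}"
begin

lemma inj_on_height: "inj_on (height E) (coend X standard_simplex affine_op)"
proof (rule inj_onI)
  fix a a' assume a: "a \<in> coend X standard_simplex affine_op" and a': "a' \<in> coend X standard_simplex affine_op"
    and eq: "height E a = height E a'"
  have ne: "S \<noteq> {}" if "S \<in> P" for S using P_mem that by blast
  obtain q z t where r: "a = rclass X (q, z, t)" "z \<in> cells X q" "t \<in> standard_simplex q"
    "strict_flag (Suc q) (E q z) t"
    using reduced_representative[OF iso sX ne a] .
  obtain q' z' t' where r': "a' = rclass X (q', z', t')" "z' \<in> cells X q'" "t' \<in> standard_simplex q'"
    "strict_flag (Suc q') (E q' z') t'"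
    using reduced_representative[OF iso sX ne a'] .
  have "Suc q = Suc q' \<and> (\<forall>l<Suc q. E q z l = E q' z' l \<and> t l = t' l)"
    using eq r r' by (intro layers_unique) (simp_all add: height_class[OF iso])
  then have *: "q' = q" "\<And>l. l \<le> q \<Longrightarrow> E q z l = E q z' l \<and> t l = t' l" by auto
  have "z = z'"
    using r(2) r'(2) * by (intro nerve_iso_inj[OF iso]) auto
  moreover have "t = t'"
  proof
    fix l show "t l = t' l"
      using r(3) r'(3) * by (cases "l \<le> q") (auto simp: standard_simplex_def)
  qed
  ultimately show "a = a'" unfolding r(1) r'(1) *(1) by simp
qed

text \<open>Labels are nested and weights sum to 1. The last label contains the support, and an
  element of the first label lies in all of them and collects the full weight.\<close>

lemma height_bounds:
  assumes "a \<in> coend X standard_simplex affine_op"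
  shows "0 \<le> height E a v" "height E a v \<le> 1"
    "\<exists>T\<in>P. \<forall>v. height E a v \<noteq> 0 \<longrightarrow> v \<in> T"
    "\<exists>T\<in>P. \<forall>v\<in>T. height E a v = 1"
proof -
  obtain q z t where r: "a = rclass X (q, z, t)" "z \<in> cells X q" "t \<in> standard_simplex q"
    using coendE[OF assms] .
  have t: "0 \<le> t l" "(\<Sum>l\<le>q. t l) = 1" for l using r(3) by (auto simp: standard_simplex_def)
  have h: "height E a v = (\<Sum>l\<le>q. if v \<in> E q z l then t l else 0)" for v
    by (simp add: r(1) height_class[OF iso] layers_def lessThan_Suc_atMost)
  show "0 \<le> height E a v" unfolding h using t by (intro sum_nonneg) auto
  have "height E a v \<le> (\<Sum>l\<le>q. t l)" unfolding h using t by (intro sum_mono) auto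
  then show "height E a v \<le> 1" using t by simp
  have "v \<in> E q z q" if nz: "height E a v \<noteq> 0" for v
  proof (rule ccontr)
    assume "v \<notin> E q z q"
    then have "v \<notin> E q z l" if "l \<le> q" for l
      using nerve_isoD(3)[OF iso r(2), of l q] that by blast
    then have "height E a v = 0" unfolding h by (intro sum.neutral) simp
    then show False using nz by simp
  qed
  then show "\<exists>T\<in>P. \<forall>v. height E a v \<noteq> 0 \<longrightarrow> v \<in> T"
    using nerve_isoD(2)[OF iso r(2) order_refl] by blast
  have "height E a v = 1" if "v \<in> E q z 0" for v
  proof -
    have "v \<in> E q z l" if "l \<le> q" for l
      using nerve_isoD(3)[OF iso r(2), of 0 l] \<open>v \<in> E q z 0\<close> that by blast
    then show ?thesis unfolding h using t by simp
  qed
  then show "\<exists>T\<in>P. \<forall>v\<in>T. height E a v = 1"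
    using nerve_isoD(2)[OF iso r(2), of 0] by blast
qed

text \<open>The superlevel sets of \<open>g\<close> form a flag in \<open>P\<close>, hence a
  simplex. An element of the smallest layer collects all weights, so their sum is the maximum of
  \<open>g\<close>; as this is 1, the weights are barycentric coordinates.\<close>

lemma height_surj:
  assumes g: "\<And>v. 0 \<le> g v" "\<And>v. g v \<le> 1" "\<exists>v. g v = 1"
    and super: "\<And>s. \<lbrakk>0 < s; s \<le> 1\<rbrakk> \<Longrightarrow> {v. s \<le> g v} \<in> P"
  shows "\<exists>a \<in> coend X standard_simplex affine_op. height E a = g"
proof -
  have "{v. g v \<noteq> 0} \<subseteq> \<Union>P"
  proof
    fix v assume "v \<in> {v. g v \<noteq> 0}"
    then have "0 < g v" using g(1)[of v] by simp
    then have "{w. g v \<le> g w} \<in> P" using super g(2) by blast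
    then show "v \<in> \<Union>P" by blast
  qed
  moreover have "finite (\<Union>P)" using finite_P P_mem by blast
  ultimately have fin: "finite {v. g v \<noteq> 0}" by (rule finite_subset)
  have ne: "{v. g v \<noteq> 0} \<noteq> {}" using g(3) by force
  obtain q S t where S: "strict_flag (Suc q) S t" "g = layers (Suc q) S t"
    and lev: "\<forall>l\<le>q. \<exists>s>0. S l = {v. s \<le> g v}"
    by (rule layers_exist[OF fin ne g(1)])
  have S_P: "S l \<in> P" if l: "l \<le> q" for l
  proof -
    obtain s where s: "0 < s" "S l = {v. s \<le> g v}" using lev l by blast
    have "S l \<noteq> {}" using S(1) l by (simp add: strict_flag_def)
    then obtain v where "s \<le> g v" using s by auto
    then show ?thesis using s super g(2)[of v] by (metis order_trans)
  qed
  obtain z where z: "z \<in> cells X q" "\<And>l. l \<le> q \<Longrightarrow> E q z l = S l"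
    by (rule nerve_iso_surj[OF iso, of q S]) (use S_P strict_flag_mono[OF S(1)] in auto)
  \<comment> \<open>Barycentric coordinates have to vanish beyond index \<open>q\<close>, where the
    decomposition leaves \<open>t\<close> unspecified.\<close>
  define t' where "t' l = (if l \<le> q then t l else 0)" for l
  have t: "0 \<le> t l" if "l \<le> q" for l
    using S(1) that unfolding strict_flag_def by (simp add: less_imp_le)
  have le: "g v \<le> (\<Sum>l\<le>q. t l)" for v
    unfolding S(2) layers_def lessThan_Suc_atMost using t by (intro sum_mono) auto
  obtain v where "v \<in> S 0" using S(1) unfolding strict_flag_def by blast
  then have "v \<in> S l" if "l \<le> q" for l using strict_flag_mono[OF S(1), of 0 l] that by auto
  then have "g v = (\<Sum>l\<le>q. t l)" unfolding S(2) layers_def lessThan_Suc_atMost by simp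
  then have sum1: "(\<Sum>l\<le>q. t l) = 1" using g(2)[of v] g(3) le by (metis order_antisym)
  have "t l \<le> 1" if "l \<le> q" for l
    using member_le_sum[of l "{..q}" t] t that sum1 by simp
  then have t': "t' \<in> standard_simplex q"
    using t sum1 by (simp add: standard_simplex_def t'_def)
  have "layers (Suc q) (E q z) t' = g"
    unfolding S(2) layers_def by (intro ext sum.cong refl) (simp add: z(2) t'_def)
  then have "height E (rclass X (q, z, t')) = g" by (simp add: height_class[OF iso])
  then show ?thesis using z(1) t' unfolding coend_def by blast
qed

end

section \<open>Topology of the realization of a finite nerve\<close>

lemma continuous_map_from_realization:
  assumes "\<And>n x. x \<in> cells X n \<Longrightarrow>
    continuous_map (subtopology (powertop_real UNIV) (standard_simplex n)) T (\<lambda>t. f (rclass X (n, x, t)))"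
  shows "continuous_map (realization X) T f"
  unfolding continuous_map_def
proof (intro conjI allI impI)
  show "f \<in> topspace (realization X) \<rightarrow> topspace T"
  proof
    fix a assume "a \<in> topspace (realization X)"
    then obtain n x t where a: "a = rclass X (n, x, t)" "x \<in> cells X n" "t \<in> standard_simplex n"
      unfolding topspace_realization by (rule coendE)
    show "f a \<in> topspace T"
      using continuous_map_funspace[OF assms[OF a(2)]] a by auto
  qed
  fix U assume U: "openin T U"
  have "openin (subtopology (powertop_real UNIV) (standard_simplex n))
      {t \<in> standard_simplex n. rclass X (n, x, t) \<in> {a \<in> topspace (realization X). f a \<in> U}}"
    if x: "x \<in> cells X n" for n x
  proof -
    have "{t \<in> standard_simplex n. rclass X (n, x, t) \<in> {a \<in> topspace (realization X). f a \<in> U}}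
        = {t \<in> topspace (subtopology (powertop_real UNIV) (standard_simplex n)). f (rclass X (n, x, t)) \<in> U}"
      using x by (auto simp: topspace_realization coend_def)
    then show ?thesis
      using openin_continuous_map_preimage[OF assms[OF x] U] by simp
  qed
  then show "openin (realization X) {a \<in> topspace (realization X). f a \<in> U}"
    unfolding openin_realization by (auto simp: topspace_realization)
qed

lemma continuous_map_rclass:
  assumes x: "x \<in> cells X n"
  shows "continuous_map (subtopology (powertop_real UNIV) (standard_simplex n)) (realization X)
    (\<lambda>t. rclass X (n, x, t))"
  unfolding continuous_map_def
proof (intro conjI allI impI)
  show "(\<lambda>t. rclass X (n, x, t)) \<in> topspace (subtopology (powertop_real UNIV) (standard_simplex n))
      \<rightarrow> topspace (realization X)"
    using x by (auto simp: topspace_realization coend_def)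
  fix U assume "openin (realization X) U"
  then show "openin (subtopology (powertop_real UNIV) (standard_simplex n))
      {t \<in> topspace (subtopology (powertop_real UNIV) (standard_simplex n)). rclass X (n, x, t) \<in> U}"
    using x unfolding openin_realization by simp
qed

context set_nerve
begin

lemma continuous_map_height: "continuous_map (realization X) (powertop_real UNIV) (height E)"
proof (rule continuous_map_from_realization)
  fix n x assume "x \<in> cells X n"
  have proj: "continuous_map (subtopology (powertop_real UNIV) (standard_simplex n)) euclideanreal (\<lambda>t. t l)"
    for l
    by (intro continuous_map_from_subtopology continuous_map_product_projection) simp
  have "continuous_map (subtopology (powertop_real UNIV) (standard_simplex n)) euclideanreal
      (\<lambda>t. layers (Suc n) (E n x) t v)" for v
    unfolding layers_def
  proof (rule continuous_map_sum)
    show "continuous_map (subtopology (powertop_real UNIV) (standard_simplex n)) euclideanreal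
        (\<lambda>t. if v \<in> E n x l then t l else 0)" for l
      by (cases "v \<in> E n x l") (simp_all add: proj)
  qed simp
  then show "continuous_map (subtopology (powertop_real UNIV) (standard_simplex n)) (powertop_real UNIV)
      (\<lambda>t. height E (rclass X (n, x, t)))"
    by (simp add: height_class[OF iso] continuous_map_componentwise_UNIV)
qed

text \<open>Strictly increasing labels force reduced representatives into dimensions below
  \<open>card P\<close>. So finitely many compact closed cells cover the realization.\<close>

lemma compact_space_realization: "compact_space (realization X)"
proof -
  define K where "K = (\<lambda>(q, z). (\<lambda>t. rclass X (q, z, t)) ` standard_simplex q) ` Sigma {..<card P} (cells X)"
  have cell: "compactin (realization X) ((\<lambda>t. rclass X (q, z, t)) ` standard_simplex q)"
    if "z \<in> cells X q" for q z
    by (rule image_compactin[OF _ continuous_map_rclass[OF that]])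
      (simp add: compactin_subtopology compactin_standard_simplex)
  have "compactin (realization X) (\<Union>K)"
  proof (rule compactin_Union)
    show "finite K"
      unfolding K_def using finite_cells_nerve_iso[OF iso finite_P] by (intro finite_imageI finite_SigmaI) auto
    show "\<And>S. S \<in> K \<Longrightarrow> compactin (realization X) S"
      unfolding K_def using cell by auto
  qed
  moreover have "\<Union>K = topspace (realization X)"
  proof
    show "\<Union>K \<subseteq> topspace (realization X)"
      using \<open>compactin (realization X) (\<Union>K)\<close> by (rule compactin_subset_topspace)
    show "topspace (realization X) \<subseteq> \<Union>K"
    proof
      fix a assume "a \<in> topspace (realization X)"
      then have a: "a \<in> coend X standard_simplex affine_op" by (simp add: topspace_realization)
      have ne: "S \<noteq> {}" if "S \<in> P" for S using P_mem that by blast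
      obtain q z t where r: "a = rclass X (q, z, t)" "z \<in> cells X q" "t \<in> standard_simplex q"
        "strict_flag (Suc q) (E q z) t"
        using reduced_representative[OF iso sX ne a] .
      have "q < card P"
      proof (rule ccontr)
        assume "\<not> q < card P"
        then have "card P \<le> q" by simp
        from label_repeats[OF iso finite_P r(2) this]
        obtain k l where kl: "q = Suc k" "l \<le> k" and eq: "E q z l = E q z (Suc l)" .
        have "E q z l \<subset> E q z (Suc l)" using r(4) kl by (simp add: strict_flag_def)
        then show False using eq by simp
      qed
      then have "(\<lambda>t. rclass X (q, z, t)) ` standard_simplex q \<in> K"
        unfolding K_def using r(2) by (intro image_eqI[of _ _ "(q, z)"]) auto
      then show "a \<in> \<Union>K" using r(1,3) by blast
    qed
  qed
  ultimately show ?thesis by (simp add: compact_space_def)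
qed

text \<open>A continuous injection from a compact space to a Hausdorff space is an embedding. The
  quotient topology can thus be exchanged for pointwise convergence of heights.\<close>

lemma embedding_map_height: "embedding_map (realization X) (powertop_real UNIV) (height E)"
proof (rule continuous_imp_embedding_map[OF continuous_map_height compact_space_realization])
  show "Hausdorff_space (powertop_real (UNIV :: 'b set))"
    by (simp add: Hausdorff_space_product_topology)
  show "inj_on (height E) (topspace (realization X))"
    by (simp add: topspace_realization inj_on_height)
qed

lemma contractible_space_subtopology_realization:
  assumes R: "R \<subseteq> topspace (realization X)"
    and c: "contractible_space (subtopology (powertop_real UNIV) (height E ` R))"
  shows "contractible_space (subtopology (realization X) R)"
proof -
  let ?Y = "subtopology (powertop_real UNIV) (height E ` topspace (realization X))"
  have "homeomorphic_map (realization X) ?Y (height E)"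
    using embedding_map_height by (simp add: embedding_map_def)
  then have "homeomorphic_map (subtopology (realization X) R) (subtopology ?Y (height E ` R)) (height E)"
    using R by (intro homeomorphic_map_subtopologies) auto
  moreover have "subtopology ?Y (height E ` R) = subtopology (powertop_real UNIV) (height E ` R)"
    using R by (simp add: subtopology_subtopology Int_absorb1 image_mono)
  ultimately show ?thesis
    using c homeomorphic_space_contractibility homeomorphic_map_imp_homeomorphic_space by metis
qed

end

text \<open>Pushing a flag forward along \<open>f\<close> turns heights into maxima over the fibres
  of \<open>f\<close>, the source of row and column maxima. The assumption on \<open>T\<close>
  concerns the single point \<open>w\<close>, because the labels in the codomain of \<kappa> are
  disjoint sums of two images and not one image.\<close>

lemma layers_image:
  assumes S: "\<And>l l'. \<lbrakk>l \<le> l'; l' < q\<rbrakk> \<Longrightarrow> S l \<subseteq> S l'" and t: "\<And>l. l < q \<Longrightarrow> 0 \<le> t l"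
    and T: "\<And>l. l < q \<Longrightarrow> w \<in> T l \<longleftrightarrow> w \<in> f ` S l"
  shows "f v = w \<Longrightarrow> layers q S t v \<le> layers q T t w"
    and "w \<in> range f \<Longrightarrow> \<exists>v. f v = w \<and> layers q S t v = layers q T t w"
proof -
  assume v: "f v = w"
  show "layers q S t v \<le> layers q T t w"
    unfolding layers_def
  proof (rule sum_mono)
    fix l assume "l \<in> {..<q}"
    then show "(if v \<in> S l then t l else 0) \<le> (if w \<in> T l then t l else 0)"
      using T[of l] t[of l] v by auto
  qed
next
  assume "w \<in> range f"
  then obtain v0 where v0: "f v0 = w" by blast
  show "\<exists>v. f v = w \<and> layers q S t v = layers q T t w"
  proof (cases "\<exists>l<q. w \<in> T l")
    case False
    then have "v0 \<notin> S l" if "l < q" for l using T that v0 by blast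
    then have "layers q S t v0 = layers q T t w"
      unfolding layers_def using False by (intro sum.cong) auto
    then show ?thesis using v0 by blast
  next
    case True
    then obtain k where k: "k < q" "w \<in> T k" and least: "\<And>l. l < k \<Longrightarrow> l < q \<Longrightarrow> w \<notin> T l"
      using exists_least_iff[of "\<lambda>l. l < q \<and> w \<in> T l"] by blast
    \<comment> \<open>A preimage \<open>v\<close> of \<open>w\<close> in the first layer that meets
      the fibre over \<open>w\<close> attains the maximum: nesting puts it in all later layers, and
      no earlier one meets that fibre.\<close>
    obtain v where v: "v \<in> S k" "f v = w" using T k by blast
    have "v \<in> S l \<longleftrightarrow> w \<in> T l" if l: "l < q" for l
    proof (cases "k \<le> l")
      case True
      then have "v \<in> S l" using S[OF True l] v by blast
      then show ?thesis using T[OF l] v by blast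
    next
      case False
      then show ?thesis using least[of l] T[OF l] l v by auto
    qed
    then have "layers q S t v = layers q T t w"
      unfolding layers_def by (intro sum.cong) auto
    then show ?thesis using v by blast
  qed
qed

section \<open>Flags of chains with prescribed projections\<close>

lemma chain_insert_fst:
  fixes S :: "('a::linorder \<times> 'b::linorder) set"
  assumes S: "S \<in> chain_sets UNIV" and i: "i \<notin> fst ` S"
  shows "\<exists>b\<in>snd ` S. insert (i, b) S \<in> chain_sets UNIV"
proof -
  have fin: "finite S" and ne: "S \<noteq> {}" and cmp: "\<And>x y. \<lbrakk>x \<in> S; y \<in> S\<rbrakk> \<Longrightarrow> x \<le> y \<or> y \<le> x"
    using S by (auto simp: chain_sets_def)
  \<comment> \<open>The new element takes the second coordinate of its predecessor \<open>p\<close>,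
    or of the least element if it has no predecessor, so the second projection does not
    change.\<close>
  have "\<exists>p\<in>S. \<forall>x\<in>S. x \<le> (i, snd p) \<or> (i, snd p) \<le> x"
  proof (cases "\<exists>p\<in>S. fst p < i")
    case True
    then have "finite {p \<in> S. fst p < i}" "{p \<in> S. fst p < i} \<noteq> {}" using fin by auto
    then obtain p where p: "p \<in> S" "fst p < i" and
      max: "\<And>x. \<lbrakk>x \<in> S; fst x < i; p \<le> x\<rbrakk> \<Longrightarrow> p = x"
      using finite_has_maximal[of "{p \<in> S. fst p < i}"] by blast
    have "x \<le> (i, snd p) \<or> (i, snd p) \<le> x" if x: "x \<in> S" for x
    proof (cases "fst x < i")
      case True
      then have "x \<le> p" using cmp[OF x p(1)] max[OF x] by blast
      then show ?thesis using True by (auto simp: less_eq_prod_def)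
    next
      case False
      moreover have "fst x \<noteq> i" using i x by blast
      moreover have "p \<le> x"
        using cmp[OF x p(1)] p(2) False by (auto simp: less_eq_prod_def)
      ultimately show ?thesis by (auto simp: less_eq_prod_def)
    qed
    then show ?thesis using p by blast
  next
    case False
    obtain p where p: "p \<in> S" and min: "\<And>x. \<lbrakk>x \<in> S; x \<le> p\<rbrakk> \<Longrightarrow> p = x"
      using finite_has_minimal[OF fin ne] by blast
    have "(i, snd p) \<le> x" if x: "x \<in> S" for x
    proof -
      have "p \<le> x" using cmp[OF p x] min[OF x] by blast
      then show ?thesis using False x by (auto simp: less_eq_prod_def)
    qed
    then show ?thesis using p by blast
  qed
  then obtain p where p: "p \<in> S" "\<forall>x\<in>S. x \<le> (i, snd p) \<or> (i, snd p) \<le> x" by blast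
  then have "insert (i, snd p) S \<in> chain_sets UNIV"
    using fin cmp by (auto simp: chain_sets_def)
  then show ?thesis using p by blast
qed

lemma chain_extend_fst:
  fixes S :: "('a::linorder \<times> 'b::linorder) set"
  assumes "finite A" and S: "S \<in> chain_sets UNIV"
  shows "\<exists>S'\<in>chain_sets UNIV. S \<subseteq> S' \<and> fst ` S' = fst ` S \<union> A \<and> snd ` S' = snd ` S"
  using assms(1)
proof induction
  case empty
  then show ?case using S by auto
next
  case (insert i A)
  then obtain S' where S': "S' \<in> chain_sets UNIV" "S \<subseteq> S'" "fst ` S' = fst ` S \<union> A" "snd ` S' = snd ` S"
    by blast
  show ?case
  proof (cases "i \<in> fst ` S'")
    case True
    then show ?thesis using S' by (intro bexI[of _ S']) auto
  next
    case False
    then obtain b where "b \<in> snd ` S'" "insert (i, b) S' \<in> chain_sets UNIV"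
      using chain_insert_fst[OF S'(1)] by blast
    then show ?thesis using S' by (intro bexI[of _ "insert (i, b) S'"]) auto
  qed
qed

lemma swap_chain_sets:
  fixes S :: "('a::linorder \<times> 'b::linorder) set"
  assumes "S \<in> chain_sets UNIV" shows "prod.swap ` S \<in> chain_sets UNIV"
proof -
  have "prod.swap x \<le> prod.swap y \<longleftrightarrow> x \<le> y" for x y :: "'a \<times> 'b"
    by (auto simp: less_eq_prod_def)
  then show ?thesis using assms unfolding chain_sets_def by simp
qed

text \<open>The missing first coordinates are inserted, then the missing second ones after
  exchanging the factors. Neither pass disturbs the projection completed by the other.\<close>

lemma chain_extend:
  fixes S :: "('a::linorder \<times> 'b::linorder) set"
  assumes S: "S \<in> chain_sets UNIV" and A: "finite A" "fst ` S \<subseteq> A" and B: "finite B" "snd ` S \<subseteq> B"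
  shows "\<exists>S'\<in>chain_sets UNIV. S \<subseteq> S' \<and> fst ` S' = A \<and> snd ` S' = B"
proof -
  obtain S1 where S1: "S1 \<in> chain_sets UNIV" "S \<subseteq> S1" "fst ` S1 = fst ` S \<union> A" "snd ` S1 = snd ` S"
    using chain_extend_fst[OF A(1) S] by blast
  obtain S2 where S2: "S2 \<in> chain_sets UNIV" "prod.swap ` S1 \<subseteq> S2"
    "fst ` S2 = fst ` prod.swap ` S1 \<union> B" "snd ` S2 = snd ` prod.swap ` S1"
    using chain_extend_fst[OF B(1) swap_chain_sets[OF S1(1)]] by (auto intro: that)
  have "fst ` prod.swap ` S1 = snd ` S1" "snd ` prod.swap ` S1 = fst ` S1"
    by (simp_all add: image_image)
  then have "fst ` prod.swap ` S2 = A" "snd ` prod.swap ` S2 = B"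
    using S1 S2 A B by (simp_all add: image_image Un_absorb1)
  moreover have "S \<subseteq> prod.swap ` S2"
  proof
    fix x assume "x \<in> S"
    then have "prod.swap x \<in> S2" using S1(2) S2(2) by blast
    then show "x \<in> prod.swap ` S2" by (metis image_eqI swap_swap)
  qed
  ultimately show ?thesis using swap_chain_sets[OF S2(1)] by blast
qed

text \<open>Starting from one point, the chain of each level is enlarged to one with the next pair
  of projections. This is what makes \<kappa> onto on simplices.\<close>

lemma chain_flag_exists:
  fixes A :: "nat \<Rightarrow> 'a::linorder set" and B :: "nat \<Rightarrow> 'b::linorder set"
  assumes "\<And>l. l \<le> q \<Longrightarrow> finite (A l) \<and> A l \<noteq> {} \<and> finite (B l) \<and> B l \<noteq> {}"
    and "\<And>l. l < q \<Longrightarrow> A l \<subseteq> A (Suc l) \<and> B l \<subseteq> B (Suc l)"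
  shows "\<exists>S. (\<forall>l\<le>q. S l \<in> chain_sets UNIV \<and> fst ` S l = A l \<and> snd ` S l = B l) \<and> (\<forall>l<q. S l \<subseteq> S (Suc l))"
  using assms
proof (induction q)
  case 0
  have "A 0 \<noteq> {}" "B 0 \<noteq> {}" using 0(1)[of 0] by simp_all
  then obtain a b where "a \<in> A 0" "b \<in> B 0" by blast
  moreover have "{(a, b)} \<in> chain_sets UNIV" by (simp add: chain_sets_def)
  ultimately obtain S' where "S' \<in> chain_sets UNIV" "fst ` S' = A 0" "snd ` S' = B 0"
    using chain_extend[of "{(a, b)}" "A 0" "B 0"] 0(1)[of 0] by auto
  then show ?case by (intro exI[of _ "\<lambda>_. S'"]) simp
next
  case (Suc q)
  then obtain S where S: "\<forall>l\<le>q. S l \<in> chain_sets UNIV \<and> fst ` S l = A l \<and> snd ` S l = B l"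
    "\<forall>l<q. S l \<subseteq> S (Suc l)" by force
  obtain S' where "S' \<in> chain_sets UNIV" "S q \<subseteq> S'" "fst ` S' = A (Suc q)" "snd ` S' = B (Suc q)"
    using chain_extend[of "S q" "A (Suc q)" "B (Suc q)"] S(1) Suc.prems(1)[of "Suc q"] Suc.prems(2)[of q]
    by auto
  then show ?case
    using S by (intro exI[of _ "S(Suc q := S')"]) (auto simp: le_Suc_eq less_Suc_eq)
qed

section \<open>Contracting the fibres\<close>

text \<open>Powers of \<open>N + 2\<close>, with exponent the rank in \<open>S\<close>. The multiple
  \<open>N\<close> pays for up to \<open>N\<close> intervals of smaller value; the extra 2 is room
  for two ramps of length 1 in the sweep.\<close>

lemma superincreasing_weights:
  fixes S :: "'b::linorder set"
  assumes "finite S"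
  obtains W :: "'b \<Rightarrow> real" where "\<And>x. 2 \<le> W x"
    and "\<And>x y. \<lbrakk>x \<in> S; y \<in> S; y < x\<rbrakk> \<Longrightarrow> real N * W y + 2 \<le> W x"
proof
  define r where "r x = card {y \<in> S. y < x}" for x
  define W where "W x = real (N + 2) ^ Suc (r x)" for x
  have ge: "real (N + 2) \<le> W x" for x
    unfolding W_def by (rule self_le_power) auto
  then show "2 \<le> W x" for x
    using ge by (simp add: order_trans[OF _ ge])
  fix x y assume "x \<in> S" "y \<in> S" "y < x"
  then have "{z \<in> S. z < y} \<subset> {z \<in> S. z < x}" by auto
  then have "r y < r x"
    unfolding r_def using assms by (intro psubset_card_mono) auto
  then have "real (N + 2) ^ Suc (Suc (r y)) \<le> W x"
    unfolding W_def by (intro power_increasing) auto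
  then have "real (N + 2) * W y \<le> W x" by (simp add: W_def)
  moreover have "2 \<le> 2 * W y" using ge[of y] by linarith
  ultimately show "real N * W y + 2 \<le> W x" by (simp add: algebra_simps)
qed

lemma continuous_map_real_Max:
  assumes "finite A" "A \<noteq> {}" "\<And>a. a \<in> A \<Longrightarrow> continuous_map X euclideanreal (f a)"
  shows "continuous_map X euclideanreal (\<lambda>x. Max ((\<lambda>a. f a x) ` A))"
  using assms
proof (induction rule: finite_ne_induct)
  case (insert a A)
  then show ?case
    by (simp add: continuous_map_real_max)
qed simp

section \<open>Couplings with given row and column maxima, as pairs of regions\<close>

locale marginals =
  fixes m n :: nat and h1 h2 :: "nat \<Rightarrow> real"
  assumes h1: "0 \<le> h1 i" "h1 i \<le> 1" and h2: "0 \<le> h2 j" "h2 j \<le> 1"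
begin

text \<open>Transport plans with sums replaced by maxima, whose support contains no two incomparable
  points.\<close>

definition couplings :: "(nat \<times> nat \<Rightarrow> real) set" where
  "couplings = {g. (\<forall>v. 0 \<le> g v) \<and> (\<forall>i j. g (i, j) \<noteq> 0 \<longrightarrow> i \<le> m \<and> j \<le> n) \<and>
     (\<forall>i j i' j'. i < i' \<longrightarrow> j' < j \<longrightarrow> g (i, j) = 0 \<or> g (i', j') = 0) \<and>
     (\<forall>i\<le>m. \<forall>j\<le>n. g (i, j) \<le> h1 i \<and> g (i, j) \<le> h2 j) \<and>
     (\<forall>i\<le>m. \<exists>j\<le>n. g (i, j) = h1 i) \<and> (\<forall>j\<le>n. \<exists>i\<le>m. g (i, j) = h2 j)}"

lemma couplingsD:
  assumes "g \<in> couplings"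
  shows "0 \<le> g v" "g (i, j) \<noteq> 0 \<Longrightarrow> i \<le> m" "g (i, j) \<noteq> 0 \<Longrightarrow> j \<le> n"
    "\<lbrakk>i < i'; j' < j\<rbrakk> \<Longrightarrow> g (i, j) = 0 \<or> g (i', j') = 0"
    "\<lbrakk>i \<le> m; j \<le> n\<rbrakk> \<Longrightarrow> g (i, j) \<le> h1 i" "\<lbrakk>i \<le> m; j \<le> n\<rbrakk> \<Longrightarrow> g (i, j) \<le> h2 j"
    "i \<le> m \<Longrightarrow> \<exists>j\<le>n. g (i, j) = h1 i" "j \<le> n \<Longrightarrow> \<exists>i\<le>m. g (i, j) = h2 j"
  using assms unfolding couplings_def mem_Collect_eq by (elim conjE; metis)+

text \<open>Drawn with \<open>i\<close> upwards and \<open>j\<close> to the right, this is the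
  maximum over the quadrant to the upper left of \<open>(i, j)\<close>. So
  \<open>t \<le> below g i j\<close> means that \<open>(i, j)\<close> lies on or under the path of
  \<open>g\<close> at level \<open>t\<close>; \<open>above\<close> is the mirror image.\<close>

definition below :: "(nat \<times> nat \<Rightarrow> real) \<Rightarrow> nat \<Rightarrow> nat \<Rightarrow> real" where
  "below g i j = Max (g ` ({i..m} \<times> {..j}))"

definition above :: "(nat \<times> nat \<Rightarrow> real) \<Rightarrow> nat \<Rightarrow> nat \<Rightarrow> real" where
  "above g i j = Max (g ` ({..i} \<times> {j..n}))"

text \<open>The superlevel set of a coupling at \<open>t\<close> is a staircase path in the grid
  \<open>{i. t \<le> h1 i} \<times> {j. t \<le> h2 j}\<close>, namely the intersection of the superlevel sets of \<open>u = below g\<close>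
  and \<open>d = above g\<close>, the two regions bounded by the path. In general, \<open>u\<close> and \<open>d\<close> are separating if at each
  level the two regions do not cross and leave no gap between adjacent points of the grid, and
  bounding if they contain the sides of the grid that every path has to respect.\<close>

definition separating :: "(nat \<Rightarrow> nat \<Rightarrow> real) \<Rightarrow> (nat \<Rightarrow> nat \<Rightarrow> real) \<Rightarrow> bool" where
  "separating u d \<longleftrightarrow>
     (\<forall>i j. i \<le> m \<longrightarrow> j \<le> n \<longrightarrow> 0 \<le> u i j \<and> 0 \<le> d i j) \<and>
     (\<forall>i j i' j'. i < i' \<longrightarrow> i' \<le> m \<longrightarrow> j' < j \<longrightarrow> j \<le> n \<longrightarrow> d i j = 0 \<or> u i' j' = 0) \<and>
     (\<forall>t>0. \<forall>i\<le>m. \<forall>j j'. j < j' \<longrightarrow> j' \<le> n \<longrightarrow> t \<le> h1 i \<longrightarrow> t \<le> h2 j \<longrightarrow> t \<le> h2 j' \<longrightarrow>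
        (\<forall>k. j < k \<longrightarrow> k < j' \<longrightarrow> h2 k < t) \<longrightarrow> t \<le> u i j \<or> t \<le> d i j') \<and>
     (\<forall>t>0. \<forall>j\<le>n. \<forall>i i'. i < i' \<longrightarrow> i' \<le> m \<longrightarrow> t \<le> h2 j \<longrightarrow> t \<le> h1 i \<longrightarrow> t \<le> h1 i' \<longrightarrow>
        (\<forall>k. i < k \<longrightarrow> k < i' \<longrightarrow> h1 k < t) \<longrightarrow> t \<le> d i j \<or> t \<le> u i' j)"

definition bounding :: "(nat \<Rightarrow> nat \<Rightarrow> real) \<Rightarrow> (nat \<Rightarrow> nat \<Rightarrow> real) \<Rightarrow> bool" where
  "bounding u d \<longleftrightarrow>
     (\<forall>t>0. \<forall>i\<le>m. \<forall>j\<le>n. t \<le> h1 i \<longrightarrow> t \<le> h2 j \<longrightarrow>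
        ((\<forall>k\<le>n. t \<le> h2 k \<longrightarrow> k \<le> j) \<longrightarrow> t \<le> u i j) \<and>
        ((\<forall>k\<le>m. t \<le> h1 k \<longrightarrow> i \<le> k) \<longrightarrow> t \<le> u i j) \<and>
        ((\<forall>k\<le>n. t \<le> h2 k \<longrightarrow> j \<le> k) \<longrightarrow> t \<le> d i j) \<and>
        ((\<forall>k\<le>m. t \<le> h1 k \<longrightarrow> k \<le> i) \<longrightarrow> t \<le> d i j))"

lemma separatingD:
  assumes "separating u d"
  shows "\<lbrakk>i \<le> m; j \<le> n\<rbrakk> \<Longrightarrow> 0 \<le> u i j" "\<lbrakk>i \<le> m; j \<le> n\<rbrakk> \<Longrightarrow> 0 \<le> d i j"
    "\<lbrakk>i < i'; i' \<le> m; j' < j; j \<le> n\<rbrakk> \<Longrightarrow> d i j = 0 \<or> u i' j' = 0"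
    "\<lbrakk>0 < t; i \<le> m; j < j'; j' \<le> n; t \<le> h1 i; t \<le> h2 j; t \<le> h2 j'; \<And>k. j < k \<Longrightarrow> k < j' \<Longrightarrow> h2 k < t\<rbrakk>
      \<Longrightarrow> t \<le> u i j \<or> t \<le> d i j'"
    "\<lbrakk>0 < t; j \<le> n; i < i'; i' \<le> m; t \<le> h2 j; t \<le> h1 i; t \<le> h1 i'; \<And>k. i < k \<Longrightarrow> k < i' \<Longrightarrow> h1 k < t\<rbrakk>
      \<Longrightarrow> t \<le> d i j \<or> t \<le> u i' j"
proof -
  note * = assms[unfolded separating_def]
  note a = *[THEN conjunct1] and b = *[THEN conjunct2]
  note c = b[THEN conjunct1] and d = b[THEN conjunct2, THEN conjunct1] and e = b[THEN conjunct2, THEN conjunct2]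
  show "\<lbrakk>i \<le> m; j \<le> n\<rbrakk> \<Longrightarrow> 0 \<le> u i j" "\<lbrakk>i \<le> m; j \<le> n\<rbrakk> \<Longrightarrow> 0 \<le> d i j"
    using a by simp_all
  show "\<lbrakk>i < i'; i' \<le> m; j' < j; j \<le> n\<rbrakk> \<Longrightarrow> d i j = 0 \<or> u i' j' = 0"
    using c by simp
  show "\<lbrakk>0 < t; i \<le> m; j < j'; j' \<le> n; t \<le> h1 i; t \<le> h2 j; t \<le> h2 j'; \<And>k. j < k \<Longrightarrow> k < j' \<Longrightarrow> h2 k < t\<rbrakk>
      \<Longrightarrow> t \<le> u i j \<or> t \<le> d i j'"
    using d by simp
  show "\<lbrakk>0 < t; j \<le> n; i < i'; i' \<le> m; t \<le> h2 j; t \<le> h1 i; t \<le> h1 i'; \<And>k. i < k \<Longrightarrow> k < i' \<Longrightarrow> h1 k < t\<rbrakk>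
      \<Longrightarrow> t \<le> d i j \<or> t \<le> u i' j"
    using e by simp
qed

lemma boundingD:
  assumes "bounding u d" "0 < t" "i \<le> m" "j \<le> n" "t \<le> h1 i" "t \<le> h2 j"
  shows "(\<And>k. \<lbrakk>k \<le> n; t \<le> h2 k\<rbrakk> \<Longrightarrow> k \<le> j) \<Longrightarrow> t \<le> u i j"
    "(\<And>k. \<lbrakk>k \<le> m; t \<le> h1 k\<rbrakk> \<Longrightarrow> i \<le> k) \<Longrightarrow> t \<le> u i j"
    "(\<And>k. \<lbrakk>k \<le> n; t \<le> h2 k\<rbrakk> \<Longrightarrow> j \<le> k) \<Longrightarrow> t \<le> d i j"
    "(\<And>k. \<lbrakk>k \<le> m; t \<le> h1 k\<rbrakk> \<Longrightarrow> k \<le> i) \<Longrightarrow> t \<le> d i j"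
  using assms unfolding bounding_def by simp_all

text \<open>The upper envelope: the regions under the paths are united, those over them intersected.
  Each condition is a disjunction between the two regions, so it survives when one grows to a union
  and the other shrinks to an intersection.\<close>

lemma separating_max_min:
  assumes "separating u d" "separating u' d'"
  shows "separating (\<lambda>i j. max (u i j) (u' i j)) (\<lambda>i j. min (d i j) (d' i j))"
  unfolding separating_def
proof (intro conjI allI impI)
  fix i j i' j' :: nat assume *: "i < i'" "i' \<le> m" "j' < j" "j \<le> n"
  then have "0 \<le> d i j" "0 \<le> d' i j" using assms by (auto intro: separatingD(2))
  then show "min (d i j) (d' i j) = 0 \<or> max (u i' j') (u' i' j') = 0"
    using separatingD(3)[OF assms(1) *] separatingD(3)[OF assms(2) *] by linarith
next
  fix t i j j' assume "0 < t" "i \<le> m" "j < j'" "j' \<le> n" "t \<le> h1 i" "t \<le> h2 j" "t \<le> h2 j'"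
    "\<forall>k. j < k \<longrightarrow> k < j' \<longrightarrow> h2 k < t"
  then show "t \<le> max (u i j) (u' i j) \<or> t \<le> min (d i j') (d' i j')"
    using separatingD(4)[OF assms(1), of t i j j'] separatingD(4)[OF assms(2), of t i j j'] by auto
next
  fix t j i i' assume "0 < t" "j \<le> n" "i < i'" "i' \<le> m" "t \<le> h2 j" "t \<le> h1 i" "t \<le> h1 i'"
    "\<forall>k. i < k \<longrightarrow> k < i' \<longrightarrow> h1 k < t"
  then show "t \<le> min (d i j) (d' i j) \<or> t \<le> max (u i' j) (u' i' j)"
    using separatingD(5)[OF assms(1), of t j i i'] separatingD(5)[OF assms(2), of t j i i'] by auto
next
  fix i j assume *: "i \<le> m" "j \<le> n"
  show "0 \<le> max (u i j) (u' i j)" "0 \<le> min (d i j) (d' i j)"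
    using separatingD(1,2)[OF assms(1) *] separatingD(1,2)[OF assms(2) *] by linarith+
qed

text \<open>The lower envelope, by the same argument with the two regions exchanged.\<close>

lemma separating_min_max:
  assumes "separating u d" "separating u' d'"
  shows "separating (\<lambda>i j. min (u i j) (u' i j)) (\<lambda>i j. max (d i j) (d' i j))"
  unfolding separating_def
proof (intro conjI allI impI)
  fix i j i' j' :: nat assume *: "i < i'" "i' \<le> m" "j' < j" "j \<le> n"
  then have "0 \<le> u i' j'" "0 \<le> u' i' j'" using assms by (auto intro: separatingD(1))
  then show "max (d i j) (d' i j) = 0 \<or> min (u i' j') (u' i' j') = 0"
    using separatingD(3)[OF assms(1) *] separatingD(3)[OF assms(2) *] by linarith
next
  fix t i j j' assume "0 < t" "i \<le> m" "j < j'" "j' \<le> n" "t \<le> h1 i" "t \<le> h2 j" "t \<le> h2 j'"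
    "\<forall>k. j < k \<longrightarrow> k < j' \<longrightarrow> h2 k < t"
  then show "t \<le> min (u i j) (u' i j) \<or> t \<le> max (d i j') (d' i j')"
    using separatingD(4)[OF assms(1), of t i j j'] separatingD(4)[OF assms(2), of t i j j'] by auto
next
  fix t j i i' assume "0 < t" "j \<le> n" "i < i'" "i' \<le> m" "t \<le> h2 j" "t \<le> h1 i" "t \<le> h1 i'"
    "\<forall>k. i < k \<longrightarrow> k < i' \<longrightarrow> h1 k < t"
  then show "t \<le> max (d i j) (d' i j) \<or> t \<le> min (u i' j) (u' i' j)"
    using separatingD(5)[OF assms(1), of t j i i'] separatingD(5)[OF assms(2), of t j i i'] by auto
next
  fix i j assume *: "i \<le> m" "j \<le> n"
  show "0 \<le> min (u i j) (u' i j)" "0 \<le> max (d i j) (d' i j)"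
    using separatingD(1,2)[OF assms(1) *] separatingD(1,2)[OF assms(2) *] by linarith+
qed

lemma le_below:
  assumes "i \<le> i'" "i' \<le> m" "j' \<le> j" shows "g (i', j') \<le> below g i j"
  unfolding below_def by (rule Max_ge) (use assms in auto)

lemma le_above:
  assumes "i' \<le> i" "j \<le> j'" "j' \<le> n" shows "g (i', j') \<le> above g i j"
  unfolding above_def by (rule Max_ge) (use assms in auto)

lemma below_attained:
  assumes "i \<le> m" obtains i' j' where "i \<le> i'" "i' \<le> m" "j' \<le> j" "below g i j = g (i', j')"
proof -
  have "below g i j \<in> g ` ({i..m} \<times> {..j})"
    unfolding below_def by (rule Max_in) (use assms in auto)
  then show thesis using that by auto
qed

lemma above_attained:
  assumes "j \<le> n" obtains i' j' where "i' \<le> i" "j \<le> j'" "j' \<le> n" "above g i j = g (i', j')"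
proof -
  have "above g i j \<in> g ` ({..i} \<times> {j..n})"
    unfolding above_def by (rule Max_in) (use assms in auto)
  then show thesis using that by auto
qed

lemma below_bounds:
  assumes "g \<in> couplings" "i \<le> m" "j \<le> n" shows "0 \<le> below g i j" "below g i j \<le> 1"
proof -
  obtain i' j' where *: "i \<le> i'" "i' \<le> m" "j' \<le> j" "below g i j = g (i', j')"
    using below_attained[OF assms(2)] .
  then show "0 \<le> below g i j" using couplingsD(1)[OF assms(1)] by simp
  show "below g i j \<le> 1"
    using * assms couplingsD(5)[OF assms(1), of i' j'] h1(2)[of i'] by simp
qed

lemma above_bounds:
  assumes "g \<in> couplings" "i \<le> m" "j \<le> n" shows "0 \<le> above g i j" "above g i j \<le> 1"
proof -
  obtain i' j' where *: "i' \<le> i" "j \<le> j'" "j' \<le> n" "above g i j = g (i', j')"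
    using above_attained[OF assms(3)] .
  then show "0 \<le> above g i j" using couplingsD(1)[OF assms(1)] by simp
  show "above g i j \<le> 1"
    using * assms couplingsD(5)[OF assms(1), of i' j'] h1(2)[of i'] by simp
qed

text \<open>A crossing would exhibit two incomparable points of the support. There is no gap, since
  row \<open>i\<close> attains its maximum in a column \<open>k\<close> of value at least
  \<open>t\<close>; such a column is not strictly between two adjacent ones, so it lies on one side.
  Columns are alike.\<close>

lemma separating_coupling:
  assumes g: "g \<in> couplings" shows "separating (below g) (above g)"
  unfolding separating_def
proof (intro conjI allI impI)
  fix i j i' j' :: nat assume *: "i < i'" "i' \<le> m" "j' < j" "j \<le> n"
  obtain a b where ab: "a \<le> i" "j \<le> b" "above g i j = g (a, b)"
    using above_attained[OF \<open>j \<le> n\<close>] by metis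
  obtain c d where cd: "i' \<le> c" "d \<le> j'" "below g i' j' = g (c, d)"
    using below_attained[OF \<open>i' \<le> m\<close>] by metis
  show "above g i j = 0 \<or> below g i' j' = 0"
    using couplingsD(4)[OF g, of a c d b] * ab cd by linarith
next
  fix t i j j' assume *: "i \<le> m" "j < j'" "j' \<le> n" "t \<le> h1 i" "\<forall>k. j < k \<longrightarrow> k < j' \<longrightarrow> h2 k < t"
  obtain k where k: "k \<le> n" "g (i, k) = h1 i" using couplingsD(7)[OF g *(1)] by blast
  then have "t \<le> h2 k" using couplingsD(6)[OF g *(1) k(1)] * by simp
  then consider "k \<le> j" | "j' \<le> k" using * by (meson not_less)
  then show "t \<le> below g i j \<or> t \<le> above g i j'"
    using le_below[of i i k j g] le_above[of i i j' k g] k * by cases auto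
next
  fix t j i i' assume *: "j \<le> n" "i < i'" "i' \<le> m" "t \<le> h2 j" "\<forall>k. i < k \<longrightarrow> k < i' \<longrightarrow> h1 k < t"
  obtain k where k: "k \<le> m" "g (k, j) = h2 j" using couplingsD(8)[OF g *(1)] by blast
  then have "t \<le> h1 k" using couplingsD(5)[OF g k(1) *(1)] * by simp
  then consider "k \<le> i" | "i' \<le> k" using * by (meson not_less)
  then show "t \<le> above g i j \<or> t \<le> below g i' j"
    using le_below[of i' k j j g] le_above[of k i j j g] k * by cases auto
qed (use below_bounds[OF g] above_bounds[OF g] in auto)

lemma bounding_coupling:
  assumes g: "g \<in> couplings" shows "bounding (below g) (above g)"
  unfolding bounding_def
proof (intro allI impI)
  fix t i j assume *: "0 < t" "i \<le> m" "j \<le> n" "t \<le> h1 i" "t \<le> h2 j"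
  obtain k where k: "k \<le> n" "g (i, k) = h1 i" using couplingsD(7)[OF g *(2)] by blast
  obtain l where l: "l \<le> m" "g (l, j) = h2 j" using couplingsD(8)[OF g *(3)] by blast
  have "t \<le> h2 k" "t \<le> h1 l"
    using couplingsD(6)[OF g *(2) k(1)] couplingsD(5)[OF g l(1) *(3)] k l * by simp_all
  then show "((\<forall>k\<le>n. t \<le> h2 k \<longrightarrow> k \<le> j) \<longrightarrow> t \<le> below g i j) \<and>
        ((\<forall>k\<le>m. t \<le> h1 k \<longrightarrow> i \<le> k) \<longrightarrow> t \<le> below g i j) \<and>
        ((\<forall>k\<le>n. t \<le> h2 k \<longrightarrow> j \<le> k) \<longrightarrow> t \<le> above g i j) \<and>
        ((\<forall>k\<le>m. t \<le> h1 k \<longrightarrow> k \<le> i) \<longrightarrow> t \<le> above g i j)"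
    using le_below[of i i k j g] le_below[of i l j j g] le_above[of i i j k g] le_above[of l i j j g]
      k l * by auto
qed

definition between :: "(nat \<Rightarrow> nat \<Rightarrow> real) \<Rightarrow> (nat \<Rightarrow> nat \<Rightarrow> real) \<Rightarrow> nat \<times> nat \<Rightarrow> real" where
  "between u d = (\<lambda>(i, j). if i \<le> m \<and> j \<le> n then min (min (h1 i) (h2 j)) (min (u i j) (d i j)) else 0)"

text \<open>To attain the maximum of row \<open>i\<close>, work at level \<open>t = h1 i\<close> in
  the columns of value at least \<open>t\<close>. The last of them is in the region \<open>u\<close>
  by \<open>bounding\<close>; take the first that is. Its predecessor is not, so the gap condition
  puts the chosen point in \<open>d\<close> as well; without a predecessor \<open>bounding\<close>
  does.\<close>

lemma between_in_couplings:
  assumes s: "separating u d" and b: "bounding u d"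
    and h12: "\<And>i. i \<le> m \<Longrightarrow> \<exists>j\<le>n. h1 i \<le> h2 j" and h21: "\<And>j. j \<le> n \<Longrightarrow> \<exists>i\<le>m. h2 j \<le> h1 i"
  shows "between u d \<in> couplings"
proof -
  have nn: "0 \<le> between u d (i, j)" for i j
    using separatingD(1,2)[OF s] h1 h2 by (auto simp: between_def)
  have row: "\<exists>j\<le>n. between u d (i, j) = h1 i" if i: "i \<le> m" for i
  proof (cases "h1 i = 0")
    case True
    then have "between u d (i, 0) = h1 i" using nn[of i 0] by (auto simp: between_def)
    then show ?thesis by blast
  next
    case False
    define t where "t = h1 i"
    have t: "0 < t" using False h1(1)[of i] by (simp add: t_def)
    define B where "B = {j. j \<le> n \<and> t \<le> h2 j}"
    have B: "finite B" "B \<noteq> {}" using h12[OF i] by (auto simp: B_def t_def)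
    have "\<exists>j. j \<in> B \<and> t \<le> u i j"
    proof (intro exI conjI)
      show "Max B \<in> B" using B by (rule Max_in)
      then show "t \<le> u i (Max B)"
        using B(1) by (intro boundingD(1)[OF b t i]) (auto simp: B_def t_def)
    qed
    then obtain j where j: "j \<in> B" "t \<le> u i j" and least: "\<And>k. k < j \<Longrightarrow> k \<in> B \<Longrightarrow> u i k < t"
      using exists_least_iff[of "\<lambda>j. j \<in> B \<and> t \<le> u i j"] by force
    have "t \<le> d i j"
    proof (cases "\<exists>k\<in>B. k < j")
      case True
      define k where "k = Max {k \<in> B. k < j}"
      have fin: "finite {k \<in> B. k < j}" using B by auto
      have "k \<in> {k \<in> B. k < j}"
        unfolding k_def using fin True by (intro Max_in) auto
      moreover have "\<And>l. k < l \<Longrightarrow> l < j \<Longrightarrow> l \<notin> B"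
        using Max_ge[OF fin] unfolding k_def by fastforce
      ultimately show ?thesis
        using separatingD(4)[OF s t i, of k j] least[of k] j by (force simp: B_def t_def)
    next
      case False
      then show ?thesis using j
        by (intro boundingD(3)[OF b t i]) (force simp: B_def t_def)+
    qed
    then have "between u d (i, j) = h1 i"
      using j i by (auto simp: between_def B_def t_def)
    then show ?thesis using j by (auto simp: B_def)
  qed
  have col: "\<exists>i\<le>m. between u d (i, j) = h2 j" if j: "j \<le> n" for j
  proof (cases "h2 j = 0")
    case True
    then have "between u d (0, j) = h2 j" using nn[of 0 j] by (auto simp: between_def)
    then show ?thesis by blast
  next
    case False
    define t where "t = h2 j"
    have t: "0 < t" using False h2(1)[of j] by (simp add: t_def)
    define A where "A = {i. i \<le> m \<and> t \<le> h1 i}"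
    have A: "finite A" "A \<noteq> {}" using h21[OF j] by (auto simp: A_def t_def)
    \<comment> \<open>Along a column the gap condition has \<open>u\<close> and \<open>d\<close>
      exchanged, so the search is for the first row in \<open>d\<close>.\<close>
    have "\<exists>i. i \<in> A \<and> t \<le> d i j"
    proof (intro exI conjI)
      show "Max A \<in> A" using A by (rule Max_in)
      then show "t \<le> d (Max A) j"
        using A(1) j by (intro boundingD(4)[OF b t]) (auto simp: A_def t_def)
    qed
    then obtain i where i: "i \<in> A" "t \<le> d i j" and least: "\<And>k. k < i \<Longrightarrow> k \<in> A \<Longrightarrow> d k j < t"
      using exists_least_iff[of "\<lambda>i. i \<in> A \<and> t \<le> d i j"] by force
    have "t \<le> u i j"
    proof (cases "\<exists>k\<in>A. k < i")
      case True
      define k where "k = Max {k \<in> A. k < i}"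
      have fin: "finite {k \<in> A. k < i}" using A by auto
      have "k \<in> {k \<in> A. k < i}"
        unfolding k_def using fin True by (intro Max_in) auto
      moreover have "\<And>l. k < l \<Longrightarrow> l < i \<Longrightarrow> l \<notin> A"
        using Max_ge[OF fin] unfolding k_def by fastforce
      ultimately show ?thesis
        using separatingD(5)[OF s t j, of k i] least[of k] i by (force simp: A_def t_def)
    next
      case False
      then show ?thesis using i j
        by (intro boundingD(2)[OF b t]) (force simp: A_def t_def)+
    qed
    then have "between u d (i, j) = h2 j"
      using j i by (auto simp: between_def A_def t_def)
    then show ?thesis using i by (auto simp: A_def)
  qed
  have chain: "between u d (i, j) = 0 \<or> between u d (i', j') = 0" if "i < i'" "j' < j" for i j i' j'
    using separatingD(3)[OF s that(1) _ that(2)] h1(1)[of i] h1(1)[of i'] h2(1)[of j] h2(1)[of j']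
      separatingD(1,2)[OF s, of i j] separatingD(1,2)[OF s, of i' j'] that
    by (auto simp: between_def min_def)
  show ?thesis
    unfolding couplings_def using nn row col chain by (auto simp: between_def split: if_splits)
qed

text \<open>A point in both regions at level \<open>s > 0\<close> has path points to its upper left
  and lower right. These are comparable, so they share its row or its column. If the point is
  neither of them, the maximum of the other line through it can only be attained at the point
  itself, by comparability with both.\<close>

lemma between_coupling:
  assumes g: "g \<in> couplings" shows "between (below g) (above g) = g"
proof
  fix v show "between (below g) (above g) v = g v"
  proof (cases v)
    case (Pair i j)
    show ?thesis
    proof (cases "i \<le> m \<and> j \<le> n")
      case False
      then show ?thesis using couplingsD(2,3)[OF g, of i j] Pair by (auto simp: between_def)
    next
      case True
      define s where "s = between (below g) (above g) (i, j)"
      have s_le: "s \<le> h1 i" "s \<le> h2 j" "s \<le> below g i j" "s \<le> above g i j"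
        using True by (auto simp: s_def between_def)
      have "g (i, j) \<le> s"
        using True couplingsD(5,6)[OF g, of i j] le_below[of i i j j g] le_above[of i i j j g]
        by (auto simp: s_def between_def)
      moreover have "s \<le> g (i, j)"
      proof (cases "s \<le> 0")
        case True then show ?thesis using couplingsD(1)[OF g, of "(i, j)"] by simp
      next
        case False
        obtain a b where ab: "i \<le> a" "a \<le> m" "b \<le> j" "below g i j = g (a, b)"
          using below_attained True by metis
        obtain c d where cd: "c \<le> i" "j \<le> d" "d \<le> n" "above g i j = g (c, d)"
          using above_attained True by metis
        obtain k where k: "k \<le> m" "g (k, j) = h2 j" using couplingsD(8)[OF g] True by blast
        obtain l where l: "l \<le> n" "g (i, l) = h1 i" using couplingsD(7)[OF g] True by blast
        have comparable: "\<not> (x < x' \<and> y' < y)" if "s \<le> g (x, y)" "s \<le> g (x', y')" for x y x' y'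
          using couplingsD(4)[OF g, of x x' y' y] that False by auto
        have "c = a \<or> b = d" using comparable[of c d a b] ab cd s_le by linarith
        then show ?thesis
        proof
          assume "c = a"
          then have [simp]: "c = i" "a = i" using ab cd by auto
          show ?thesis
          proof (cases "j = b \<or> j = d")
            case True then show ?thesis using ab cd s_le by auto
          next
            case False
            then have "k = i"
              using comparable[of k j i b] comparable[of i d k j] ab cd s_le k by (auto simp: not_less)
            then show ?thesis using k s_le by simp
          qed
        next
          assume "b = d"
          then have [simp]: "b = j" "d = j" using ab cd by auto
          show ?thesis
          proof (cases "i = a \<or> i = c")
            case True then show ?thesis using ab cd s_le by auto
          next
            case False
            then have "l = j"
              using comparable[of c j i l] comparable[of i l a j] ab cd s_le l by (auto simp: not_less)
            then show ?thesis using l s_le by simp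
          qed
        qed
      qed
      ultimately show ?thesis using Pair s_def by simp
    qed
  qed
qed

text \<open>Cut two lines into consecutive intervals of lengths \<open>W (h1 i)\<close> and \<open>W (h2 j)\<close> and slide one along
  the other; \<open>(i, j)\<close> is on the staircase at time \<open>s\<close> if the corresponding intervals overlap.
  As \<open>W\<close> is superincreasing, an interval is longer than any union of intervals of lower value, so that
  omitting the rows and columns of low value never disconnects the staircase.\<close>

lemma ex_sweep:
  "\<exists>u d. (\<forall>\<tau>. separating (u \<tau>) (d \<tau>)) \<and>
     (\<forall>i j. continuous_on UNIV (\<lambda>\<tau>. u \<tau> i j) \<and> continuous_on UNIV (\<lambda>\<tau>. d \<tau> i j)) \<and>
     (\<forall>i\<le>m. \<forall>j\<le>n. u (0::real) i j = 1 \<and> d 0 i j = 0 \<and> u 1 i j = 0 \<and> d 1 i j = 1)"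
proof -
  \<comment> \<open>Bounds the number of rows or columns in any gap, and is positive so that one may
    divide by it.\<close>
  define N where "N = m + n + 1"
  obtain W :: "real \<Rightarrow> real" where W: "\<And>x. 2 \<le> W x"
    and Wlt: "\<And>x y. \<lbrakk>x \<in> h1 ` {..m} \<union> h2 ` {..n}; y \<in> h1 ` {..m} \<union> h2 ` {..n}; y < x\<rbrakk>
      \<Longrightarrow> real N * W y + 2 \<le> W x"
    by (rule superincreasing_weights[of "h1 ` {..m} \<union> h2 ` {..n}" N]) auto
  have W_sum: "(\<Sum>k\<in>K. W (h k)) + 2 \<le> W x"
    if K: "finite K" "card K \<le> N" and x: "x \<in> h1 ` {..m} \<union> h2 ` {..n}"
      and h: "\<And>k. k \<in> K \<Longrightarrow> h k \<in> h1 ` {..m} \<union> h2 ` {..n} \<and> h k < x" for K :: "nat set" and h x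
  proof -
    have "W (h k) \<le> (W x - 2) / real N" if "k \<in> K" for k
      using Wlt[OF x, of "h k"] h[OF that] by (simp add: N_def field_simps)
    then have "(\<Sum>k\<in>K. W (h k)) \<le> of_nat (card K) * ((W x - 2) / real N)"
      by (rule sum_bounded_above)
    also have "\<dots> \<le> real N * ((W x - 2) / real N)"
      using K W[of x] by (intro mult_right_mono) auto
    finally show ?thesis by (simp add: N_def)
  qed
  have Wnn: "0 \<le> W x" for x using W[of x] by linarith
  \<comment> \<open>With the rows displaced by a real number x, the intervals of row
    \<open>i\<close> and column \<open>j\<close> meet exactly when
    \<open>ld i j \<le> x \<le> lu i j\<close>: \<open>lu\<close> compares the end of the column
    with the start of the row, \<open>ld\<close> the start with the end.\<close>
  define lu where "lu i j = (\<Sum>k\<le>j. W (h2 k)) - (\<Sum>k<i. W (h1 k))" for i j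
  define ld where "ld i j = (\<Sum>k<j. W (h2 k)) - (\<Sum>k\<le>i. W (h1 k))" for i j
  \<comment> \<open>Exceeds every threshold on the grid by at least 1, so at displacements
    \<open>-T\<close> and \<open>T\<close> all ramps are saturated.\<close>
  define T where "T = (\<Sum>k\<le>n. W (h2 k)) + (\<Sum>k\<le>m. W (h1 k)) + 1"
  define clamp where "clamp x = max 0 (min 1 x)" for x :: real
  define \<theta> where "\<theta> s = (2 * s - 1) * T" for s
  define u where "u s i j = clamp (lu i j - \<theta> s)" for s i j
  define d where "d s i j = clamp (\<theta> s - ld i j)" for s i j
  have sep: "separating (u s) (d s)" for s
    unfolding separating_def
  proof (intro conjI allI impI)
    fix i j i' j' :: nat assume *: "i < i'" "i' \<le> m" "j' < j" "j \<le> n"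
    have "(\<Sum>k\<le>j'. W (h2 k)) \<le> (\<Sum>k<j. W (h2 k))"
      using * Wnn by (intro sum_mono2) auto
    moreover have "(\<Sum>k\<le>i. W (h1 k)) \<le> (\<Sum>k<i'. W (h1 k))"
      using * Wnn by (intro sum_mono2) auto
    ultimately have "lu i' j' \<le> ld i j" by (simp add: lu_def ld_def)
    then show "d s i j = 0 \<or> u s i' j' = 0" by (auto simp: u_def d_def clamp_def)
  next
    fix t i j j' assume *: "i \<le> m" "j < j'" "j' \<le> n" "t \<le> h1 i" "\<forall>k. j < k \<longrightarrow> k < j' \<longrightarrow> h2 k < t"
    \<comment> \<open>The skipped columns have value below \<open>t\<close>, hence below
      \<open>h1 i\<close>; together they are shorter than the interval of row
      \<open>i\<close>.\<close>
    have "(\<Sum>k\<in>{j<..<j'}. W (h2 k)) + 2 \<le> W (h1 i)"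
      using * by (intro W_sum) (force simp: N_def)+
    moreover have "{..<j'} = {..j} \<union> {j<..<j'}" using * by auto
    then have "(\<Sum>k<j'. W (h2 k)) = (\<Sum>k\<le>j. W (h2 k)) + (\<Sum>k\<in>{j<..<j'}. W (h2 k))"
      by (simp add: sum.union_disjoint[symmetric] disjoint_iff)
    moreover have "(\<Sum>k\<le>i. W (h1 k)) = (\<Sum>k<i. W (h1 k)) + W (h1 i)"
      by (simp add: lessThan_Suc_atMost[symmetric])
    \<comment> \<open>With thresholds 2 apart, every displacement is at least 1 beyond
      \<open>ld\<close> or at least 1 short of \<open>lu\<close>, so one of the two ramps has
      reached its full value 1.\<close>
    ultimately have "ld i j' + 2 \<le> lu i j" by (simp add: lu_def ld_def)
    moreover have "t \<le> 1" using * h1(2)[of i] by linarith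
    ultimately show "t \<le> u s i j \<or> t \<le> d s i j'" by (auto simp: u_def d_def clamp_def)
  next
    fix t j i i' assume *: "j \<le> n" "i < i'" "i' \<le> m" "t \<le> h2 j" "\<forall>k. i < k \<longrightarrow> k < i' \<longrightarrow> h1 k < t"
    have "(\<Sum>k\<in>{i<..<i'}. W (h1 k)) + 2 \<le> W (h2 j)"
      using * by (intro W_sum) (force simp: N_def)+
    moreover have "{..<i'} = {..i} \<union> {i<..<i'}" using * by auto
    then have "(\<Sum>k<i'. W (h1 k)) = (\<Sum>k\<le>i. W (h1 k)) + (\<Sum>k\<in>{i<..<i'}. W (h1 k))"
      by (simp add: sum.union_disjoint[symmetric] disjoint_iff)
    moreover have "(\<Sum>k\<le>j. W (h2 k)) = (\<Sum>k<j. W (h2 k)) + W (h2 j)"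
      by (simp add: lessThan_Suc_atMost[symmetric])
    ultimately have "ld i j + 2 \<le> lu i' j" by (simp add: lu_def ld_def)
    moreover have "t \<le> 1" using * h2(2)[of j] by linarith
    ultimately show "t \<le> d s i j \<or> t \<le> u s i' j" by (auto simp: u_def d_def clamp_def)
  qed (auto simp: u_def d_def clamp_def)
  have bounds: "\<bar>lu i j\<bar> \<le> T - 1" "\<bar>ld i j\<bar> \<le> T - 1" if "i \<le> m" "j \<le> n" for i j
  proof -
    have le: "(\<Sum>k\<in>K. W (h k)) \<le> (\<Sum>k\<le>p. W (h k))" "0 \<le> (\<Sum>k\<in>K. W (h k))"
      if "K \<subseteq> {..p}" for K and h :: "nat \<Rightarrow> real" and p :: nat
      using that Wnn by (auto intro!: sum_mono2 sum_nonneg)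
    have "{..j} \<subseteq> {..n}" "{..<j} \<subseteq> {..n}" "{..i} \<subseteq> {..m}" "{..<i} \<subseteq> {..m}" using that by auto
    from le[OF this(1), of h2] le[OF this(2), of h2] le[OF this(3), of h1] le[OF this(4), of h1]
    show "\<bar>lu i j\<bar> \<le> T - 1" "\<bar>ld i j\<bar> \<le> T - 1"
      unfolding lu_def ld_def T_def by linarith+
  qed
  have "continuous_on UNIV (\<lambda>s. u s i j)" "continuous_on UNIV (\<lambda>s. d s i j)" for i j
    unfolding u_def d_def clamp_def \<theta>_def by (intro continuous_intros)+
  moreover have "u 0 i j = 1 \<and> d 0 i j = 0 \<and> u 1 i j = 0 \<and> d 1 i j = 1" if "i \<le> m" "j \<le> n" for i j
    using bounds[OF that] unfolding u_def d_def clamp_def \<theta>_def by (auto simp: abs_le_iff)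
  ultimately show ?thesis using sep by blast
qed

text \<open>The meet of \<open>g\<close> with the join of \<open>g'\<close> and the sweep. It is
  \<open>g\<close> while the sweep is at the top and the meet of \<open>g\<close> and
  \<open>g'\<close> once it is at the bottom.\<close>

definition deform ::
    "(nat \<Rightarrow> nat \<Rightarrow> real) \<Rightarrow> (nat \<Rightarrow> nat \<Rightarrow> real) \<Rightarrow> (nat \<times> nat \<Rightarrow> real) \<Rightarrow> (nat \<times> nat \<Rightarrow> real) \<Rightarrow>
     nat \<times> nat \<Rightarrow> real" where
  "deform u d g g' = between (\<lambda>i j. min (below g i j) (max (below g' i j) (u i j)))
                             (\<lambda>i j. max (above g i j) (min (above g' i j) (d i j)))"

text \<open>Separation passes through envelopes. The boundary conditions need no contribution from
  the sweep: in each region the bounds for \<open>g\<close> and \<open>g'\<close> already imply the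
  bound for the combination.\<close>

lemma deform_in_couplings:
  assumes g: "g \<in> couplings" and g': "g' \<in> couplings" and s: "separating u d"
  shows "deform u d g g' \<in> couplings"
  unfolding deform_def
proof (rule between_in_couplings)
  show "separating (\<lambda>i j. min (below g i j) (max (below g' i j) (u i j)))
                   (\<lambda>i j. max (above g i j) (min (above g' i j) (d i j)))"
    by (intro separating_min_max separating_max_min separating_coupling g g' s)
  show "bounding (\<lambda>i j. min (below g i j) (max (below g' i j) (u i j)))
                   (\<lambda>i j. max (above g i j) (min (above g' i j) (d i j)))"
    using bounding_coupling[OF g] bounding_coupling[OF g'] unfolding bounding_def
    by (simp add: le_max_iff_disj)
  show "\<exists>j\<le>n. h1 i \<le> h2 j" if "i \<le> m" for i
    using couplingsD(7)[OF g that] couplingsD(6)[OF g that] by metis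
  show "\<exists>i\<le>m. h2 j \<le> h1 i" if "j \<le> n" for j
    using couplingsD(8)[OF g that] couplingsD(5)[OF g _ that] by metis
qed

lemma continuous_map_deform:
  assumes f: "continuous_map Z (powertop_real UNIV) f" and f': "continuous_map Z (powertop_real UNIV) f'"
    and u: "\<And>i j. continuous_map Z euclideanreal (\<lambda>z. u z i j)"
    and d: "\<And>i j. continuous_map Z euclideanreal (\<lambda>z. d z i j)"
  shows "continuous_map Z (powertop_real UNIV) (\<lambda>z. deform (u z) (d z) (f z) (f' z))"
proof -
  \<comment> \<open>The maximum is over a non-empty set only for \<open>i \<le> m\<close>, and for
    \<open>above\<close> only for \<open>j \<le> n\<close>; elsewhere \<open>between\<close> is
    0.\<close>
  have below: "continuous_map Z euclideanreal (\<lambda>z. below (f z) i j)"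
    if "continuous_map Z (powertop_real UNIV) f" "i \<le> m" for f i j
    unfolding below_def
    by (rule continuous_map_real_Max) (use that in \<open>auto simp: continuous_map_componentwise_UNIV\<close>)
  have above: "continuous_map Z euclideanreal (\<lambda>z. above (f z) i j)"
    if "continuous_map Z (powertop_real UNIV) f" "j \<le> n" for f i j
    unfolding above_def
    by (rule continuous_map_real_Max) (use that in \<open>auto simp: continuous_map_componentwise_UNIV\<close>)
  have "continuous_map Z euclideanreal (\<lambda>z. deform (u z) (d z) (f z) (f' z) (i, j))" for i j
    by (cases "i \<le> m \<and> j \<le> n")
      (auto simp: deform_def between_def f f' intro!: continuous_map_real_min continuous_map_real_max below above u d)
  then show ?thesis by (simp add: continuous_map_componentwise_UNIV)
qed

text \<open>Both the identity and the constant map at a coupling \<open>g0\<close> are homotopic to the meet with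
  \<open>g0\<close>.\<close>

lemma contractible_couplings:
  "contractible_space (subtopology (powertop_real UNIV) couplings)"
proof (cases "couplings = {}")
  \<comment> \<open>The maxima \<open>h1\<close> and \<open>h2\<close> are arbitrary here and may
    admit no coupling.\<close>
  case True
  then show ?thesis by (simp add: contractible_space_empty)
next
  case False
  then obtain g0 where g0: "g0 \<in> couplings" by blast
  obtain u d where sep: "\<And>\<tau>::real. separating (u \<tau>) (d \<tau>)"
    and cont: "\<And>i j. continuous_on UNIV (\<lambda>\<tau>. u \<tau> i j)" "\<And>i j. continuous_on UNIV (\<lambda>\<tau>. d \<tau> i j)"
    and ends: "\<And>i j. \<lbrakk>i \<le> m; j \<le> n\<rbrakk> \<Longrightarrow> u 0 i j = 1 \<and> d 0 i j = 0 \<and> u 1 i j = 0 \<and> d 1 i j = 1"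
    using ex_sweep by blast
  let ?C = "subtopology (powertop_real UNIV) couplings"
  let ?Z = "prod_topology (top_of_set {0..1::real}) ?C"
  have start: "deform (u 0) (d 0) g g' = g" if g: "g \<in> couplings" and g': "g' \<in> couplings" for g g'
  proof -
    have "min (below g i j) (max (below g' i j) (u 0 i j)) = below g i j"
         "max (above g i j) (min (above g' i j) (d 0 i j)) = above g i j"
      if "i \<le> m" "j \<le> n" for i j
      using ends[OF that] below_bounds[OF g that] below_bounds[OF g' that]
        above_bounds[OF g that] above_bounds[OF g' that] by linarith+
    then have "deform (u 0) (d 0) g g' = between (below g) (above g)"
      unfolding deform_def between_def by (auto simp: fun_eq_iff)
    then show ?thesis by (simp add: between_coupling[OF g])
  qed
  \<comment> \<open>The meet is symmetric. So the deformation with \<open>g0\<close> in the first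
    place leads from the constant map to the very map in which the deformation of the identity
    ends.\<close>
  have finish: "deform (u 1) (d 1) g g' = deform (u 1) (d 1) g' g"
    if g: "g \<in> couplings" and g': "g' \<in> couplings" for g g'
  proof -
    have "min (below g i j) (max (below g' i j) (u 1 i j)) = min (below g' i j) (max (below g i j) (u 1 i j))"
         "max (above g i j) (min (above g' i j) (d 1 i j)) = max (above g' i j) (min (above g i j) (d 1 i j))"
      if "i \<le> m" "j \<le> n" for i j
      using ends[OF that] below_bounds[OF g that] below_bounds[OF g' that]
        above_bounds[OF g that] above_bounds[OF g' that] by linarith+
    then show ?thesis
      unfolding deform_def between_def by (auto simp: fun_eq_iff)
  qed
  have cont': "continuous_map ?Z euclideanreal (\<lambda>z. u (fst z) i j)"
     "continuous_map ?Z euclideanreal (\<lambda>z. d (fst z) i j)" for i j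
  proof -
    have "continuous_map (top_of_set {0..1}) euclideanreal (\<lambda>\<tau>. u \<tau> i j)"
         "continuous_map (top_of_set {0..1}) euclideanreal (\<lambda>\<tau>. d \<tau> i j)"
      using continuous_on_subset[OF cont(1)] continuous_on_subset[OF cont(2)] by auto
    from this[THEN continuous_map_compose[OF continuous_map_fst]]
    show "continuous_map ?Z euclideanreal (\<lambda>z. u (fst z) i j)"
       "continuous_map ?Z euclideanreal (\<lambda>z. d (fst z) i j)"
      by (simp_all add: o_def)
  qed
  have sndc: "continuous_map ?Z (powertop_real UNIV) snd"
    using continuous_map_snd[of "top_of_set {0..1::real}" ?C] by (simp add: continuous_map_in_subtopology)
  have constc: "continuous_map ?Z (powertop_real UNIV) (\<lambda>z. g0)" by simp
  have in_C: "deform (u \<tau>) (d \<tau>) g g' \<in> couplings"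
    if "g \<in> couplings" "g' \<in> couplings" for \<tau> g g'
    using that sep by (intro deform_in_couplings)
  have "homotopic_with (\<lambda>x. True) ?C ?C id (\<lambda>g. deform (u 1) (d 1) g g0)"
  proof (subst homotopic_with; (intro exI[of _ "\<lambda>z. deform (u (fst z)) (d (fst z)) (snd z) g0"] conjI ballI)?)
    show "continuous_map ?Z ?C (\<lambda>z. deform (u (fst z)) (d (fst z)) (snd z) g0)"
      using in_C g0 by (auto simp: continuous_map_in_subtopology intro!: continuous_map_deform cont' sndc)
  qed (use start[OF _ g0] in auto)
  moreover have "homotopic_with (\<lambda>x. True) ?C ?C (\<lambda>g. deform (u 1) (d 1) g g0) (\<lambda>g. g0)"
  proof (subst homotopic_with_sym, subst homotopic_with;
      (intro exI[of _ "\<lambda>z. deform (u (fst z)) (d (fst z)) g0 (snd z)"] conjI ballI)?)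
    show "continuous_map ?Z ?C (\<lambda>z. deform (u (fst z)) (d (fst z)) g0 (snd z))"
      using in_C g0 by (auto simp: continuous_map_in_subtopology intro!: continuous_map_deform cont' sndc)
  qed (use start[OF g0] finish[OF g0] in auto)
  ultimately show ?thesis
    unfolding contractible_space_def using homotopic_with_trans by blast
qed

end

section \<open>The fibres of the realization of kappa\<close>

lemma Plus_subset_iff: "A <+> B \<subseteq> C <+> D \<longleftrightarrow> A \<subseteq> C \<and> B \<subseteq> D"
  by (auto simp: Plus_def)

locale kappa_map =
  fixes m n :: nat
begin

abbreviation "src \<equiv> Sd (Delta m \<times>\<^sub>s Delta n)"
abbreviation "tgt \<equiv> Sd (Delta m) \<times>\<^sub>s Sd (Delta n)"

definition "pair_label = (\<lambda>q z. \<lambda>l\<in>{..q}. (fst z l :: nat, snd z l :: nat))"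
definition "src_label = Sd_label pair_label"
definition "factor_label = Sd_label (\<lambda>q x :: nat \<Rightarrow> nat. x)"
text \<open>The disjoint sum gives a point of the codomain one height function on
  \<open>nat + nat\<close>: its \<open>Inl\<close> part prescribes the row maxima, its
  \<open>Inr\<close> part the column maxima.\<close>

definition "tgt_label = (\<lambda>q z. \<lambda>l\<in>{..q}. factor_label q (fst z) l <+> factor_label q (snd z) l)"
definition "src_sets = chain_sets {(i, j) | i j. i \<in> {..m} \<and> j \<in> {..n}}"
definition "tgt_sets = {A <+> B | A B. A \<in> chain_sets {..m} \<and> B \<in> chain_sets {..n}}"

lemma iso_pair: "nerve_iso (Delta m \<times>\<^sub>s Delta n) pair_label {(i, j) | i j. i \<in> {..m} \<and> j \<in> {..n}}"
  unfolding pair_label_def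
  by (rule nerve_iso_prod[OF simplicial_set_Delta nerve_iso_Delta simplicial_set_Delta nerve_iso_Delta])
    (simp add: less_eq_prod_def)

lemma iso_src: "nerve_iso src src_label src_sets"
  unfolding src_label_def src_sets_def
  by (rule nerve_iso_Sd[OF iso_pair simplicial_set_prod[OF simplicial_set_Delta simplicial_set_Delta]])

lemma iso_factor: "nerve_iso (Sd (Delta k)) factor_label (chain_sets {..k})"
  unfolding factor_label_def by (rule nerve_iso_Sd[OF nerve_iso_Delta simplicial_set_Delta])

lemma iso_tgt: "nerve_iso tgt tgt_label tgt_sets"
  unfolding tgt_label_def tgt_sets_def
  by (rule nerve_iso_prod[OF simplicial_set_Sd iso_factor simplicial_set_Sd iso_factor])
    (rule Plus_subset_iff)

lemma chain_sets_mem: "S \<in> chain_sets Q \<Longrightarrow> finite S \<and> S \<noteq> {}"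
  by (simp add: chain_sets_def)

sublocale src: set_nerve src src_label src_sets
proof (rule set_nerve.intro)
  have "{(i, j) | i j. i \<in> {..m} \<and> j \<in> {..n}} = {..m} \<times> {..n}" by auto
  then show "finite src_sets" unfolding src_sets_def by (simp add: finite_chain_sets)
  show "finite S \<and> S \<noteq> {}" if "S \<in> src_sets" for S
    using that unfolding src_sets_def by (rule chain_sets_mem)
qed (rule simplicial_set_Sd iso_src)+

sublocale tgt: set_nerve tgt tgt_label tgt_sets
proof (rule set_nerve.intro)
  have "tgt_sets = (\<lambda>(A, B). A <+> B) ` (chain_sets {..m} \<times> chain_sets {..n})"
    unfolding tgt_sets_def by auto
  then show "finite tgt_sets" by (simp add: finite_chain_sets)
  show "finite S \<and> S \<noteq> {}" if "S \<in> tgt_sets" for S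
    using that unfolding tgt_sets_def by (auto simp: chain_sets_def)
qed (rule simplicial_set_prod simplicial_set_Sd iso_tgt)+

text \<open>Both components of \<kappa> keep the flag \<open>c\<close> of a representative and only
  project its simplex, so on labels \<kappa> takes the images of a chain under the two
  projections.\<close>

lemma tgt_label_kappa:
  assumes z: "z \<in> cells src q" and l: "l \<le> q"
  shows "tgt_label q (kappa m n q z) l = fst ` src_label q z l <+> snd ` src_label q z l"
proof -
  obtain k x c where z: "z = Sd_class (Delta m \<times>\<^sub>s Delta n) q (k, x, c)"
    "x \<in> cells (Delta m \<times>\<^sub>s Delta n) k" "c \<in> cells (nerve (faces k)) q"
    using z by (rule Sd_cellE)
  have c: "c l \<subseteq> {..k}" using cells_nerve_faces(1)[OF z(3) l] .
  have kap: "kappa m n q z = (Sd_class (Delta m) q (k, fst x, c), Sd_class (Delta n) q (k, snd x, c))"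
    unfolding kappa_def sset_pair_def z(1)
    by (simp add: Sd_map_class[OF simplicial_map_pr1] Sd_map_class[OF simplicial_map_pr2] pr1_def pr2_def)
  have "tgt_label q (kappa m n q z) l = fst x ` c l <+> snd x ` c l"
    unfolding tgt_label_def factor_label_def kap using l
    by (simp add: Sd_label_class[OF nerve_iso_Delta])
  moreover have "src_label q z l = pair_label k x ` c l"
    unfolding src_label_def z(1) using l by (simp add: Sd_label_class[OF iso_pair])
  moreover have "fst ` pair_label k x ` c l = fst x ` c l" "snd ` pair_label k x ` c l = snd x ` c l"
    unfolding pair_label_def image_image using c by (auto intro!: image_cong)
  ultimately show ?thesis by simp
qed

lemma height_kappa:
  assumes a: "a \<in> topspace (realization src)"
  shows "height src_label a (i, j) \<le> height tgt_label (realization_map tgt (kappa m n) a) (Inl i)"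
    and "\<exists>j. height src_label a (i, j) = height tgt_label (realization_map tgt (kappa m n) a) (Inl i)"
    and "height src_label a (i, j) \<le> height tgt_label (realization_map tgt (kappa m n) a) (Inr j)"
    and "\<exists>i. height src_label a (i, j) = height tgt_label (realization_map tgt (kappa m n) a) (Inr j)"
proof -
  obtain q z t where r: "a = rclass src (q, z, t)" "z \<in> cells src q" "t \<in> standard_simplex q"
    using a unfolding topspace_realization by (rule coendE)
  have h: "height src_label a = layers (Suc q) (src_label q z) t"
    "height tgt_label (realization_map tgt (kappa m n) a) = layers (Suc q) (tgt_label q (kappa m n q z)) t"
    unfolding r(1) realization_map_class[OF simplicial_map_kappa]
    by (simp_all add: height_class[OF iso_src] height_class[OF iso_tgt])
  have mono: "src_label q z l \<subseteq> src_label q z l'" if "l \<le> l'" "l' < Suc q" for l l'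
    using nerve_isoD(3)[OF iso_src r(2), of l l'] that by simp
  have t: "0 \<le> t l" for l using r(3) by (auto simp: standard_simplex_def)
  have Inl: "Inl i \<in> tgt_label q (kappa m n q z) l \<longleftrightarrow> Inl i \<in> (Inl \<circ> fst) ` src_label q z l"
    and Inr: "Inr j \<in> tgt_label q (kappa m n q z) l \<longleftrightarrow> Inr j \<in> (Inr \<circ> snd) ` src_label q z l"
    if "l < Suc q" for l
    using tgt_label_kappa[OF r(2), of l] that by (auto simp: image_iff)
  let ?S = "src_label q z" and ?T = "tgt_label q (kappa m n q z)"
  have le: "layers (Suc q) ?S t v \<le> layers (Suc q) ?T t w"
    if T: "\<And>l. l < Suc q \<Longrightarrow> w \<in> ?T l \<longleftrightarrow> w \<in> f ` ?S l" and v: "f v = w" for f v w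
  proof (rule layers_image(1)[where f = f])
    show "?S l \<subseteq> ?S l'" if "l \<le> l'" "l' < Suc q" for l l' using that by (rule mono)
    show "0 \<le> t l" for l by (rule t)
    show "w \<in> ?T l \<longleftrightarrow> w \<in> f ` ?S l" if "l < Suc q" for l using that by (rule T)
  qed (rule v)
  have ex: "\<exists>v. f v = w \<and> layers (Suc q) ?S t v = layers (Suc q) ?T t w"
    if T: "\<And>l. l < Suc q \<Longrightarrow> w \<in> ?T l \<longleftrightarrow> w \<in> f ` ?S l" and w: "w \<in> range f" for f w
  proof (rule layers_image(2)[where f = f])
    show "?S l \<subseteq> ?S l'" if "l \<le> l'" "l' < Suc q" for l l' using that by (rule mono)
    show "0 \<le> t l" for l by (rule t)
    show "w \<in> ?T l \<longleftrightarrow> w \<in> f ` ?S l" if "l < Suc q" for l using that by (rule T)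
  qed (rule w)
  show "height src_label a (i, j) \<le> height tgt_label (realization_map tgt (kappa m n) a) (Inl i)"
    unfolding h by (rule le[OF Inl]) simp_all
  show "height src_label a (i, j) \<le> height tgt_label (realization_map tgt (kappa m n) a) (Inr j)"
    unfolding h by (rule le[OF Inr]) simp_all
  have "Inl i = (Inl \<circ> fst) (i, j)" "Inr j = (Inr \<circ> snd) (i, j)" by simp_all
  then have rng: "Inl i \<in> range (Inl \<circ> fst :: nat \<times> nat \<Rightarrow> nat + nat)"
    "Inr j \<in> range (Inr \<circ> snd :: nat \<times> nat \<Rightarrow> nat + nat)"
    by (blast intro: range_eqI)+
  show "\<exists>j. height src_label a (i, j) = height tgt_label (realization_map tgt (kappa m n) a) (Inl i)"
    unfolding h using ex[OF Inl rng(1)] by force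
  show "\<exists>i. height src_label a (i, j) = height tgt_label (realization_map tgt (kappa m n) a) (Inr j)"
    unfolding h using ex[OF Inr rng(2)] by force
qed

text \<open>The labels of \<open>w\<close> are two increasing sequences of chains; a flag of chains
  in the grid with these projections is the label of a preimage.\<close>

lemma kappa_surj:
  assumes w: "w \<in> cells tgt q"
  shows "\<exists>z\<in>cells src q. kappa m n q z = w"
proof -
  have w: "fst w \<in> cells (Sd (Delta m)) q" "snd w \<in> cells (Sd (Delta n)) q" "w \<in> cells tgt q"
    using w by (auto simp: sset_prod_def)
  let ?A = "factor_label q (fst w)" and ?B = "factor_label q (snd w)"
  note A = nerve_isoD(2,3)[OF iso_factor w(1)] and B = nerve_isoD(2,3)[OF iso_factor w(2)]
  have "\<exists>S. (\<forall>l\<le>q. S l \<in> chain_sets UNIV \<and> fst ` S l = ?A l \<and> snd ` S l = ?B l) \<and> (\<forall>l<q. S l \<subseteq> S (Suc l))"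
  proof (rule chain_flag_exists)
    show "finite (?A l) \<and> ?A l \<noteq> {} \<and> finite (?B l) \<and> ?B l \<noteq> {}" if "l \<le> q" for l
      using chain_sets_mem[OF A(1)[OF that]] chain_sets_mem[OF B(1)[OF that]] by blast
    show "?A l \<subseteq> ?A (Suc l) \<and> ?B l \<subseteq> ?B (Suc l)" if "l < q" for l
      using A(2)[of l "Suc l"] B(2)[of l "Suc l"] that by simp
  qed
  then obtain S where "\<forall>l\<le>q. S l \<in> chain_sets UNIV \<and> fst ` S l = ?A l \<and> snd ` S l = ?B l"
    and "\<forall>l<q. S l \<subseteq> S (Suc l)" by (elim exE conjE)
  then have S: "\<And>l. l \<le> q \<Longrightarrow> S l \<in> chain_sets UNIV \<and> fst ` S l = ?A l \<and> snd ` S l = ?B l"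
    and Suc: "\<And>l. l < q \<Longrightarrow> S l \<subseteq> S (Suc l)" by simp_all
  have mono: "S l \<subseteq> S l'" if "l \<le> l'" "l' \<le> q" for l l'
    using that
  proof (induction l' rule: dec_induct)
    case (step k)
    then show ?case using Suc[of k] by simp
  qed simp
  have mem: "S l \<in> src_sets" if "l \<le> q" for l
  proof -
    have "S l \<subseteq> fst ` S l \<times> snd ` S l" by (rule subset_fst_snd)
    also have "\<dots> \<subseteq> {..m} \<times> {..n}"
      using S[OF that] A(1)[OF that] B(1)[OF that] by (simp add: chain_sets_def Sigma_mono)
    also have "\<dots> = {(i, j) | i j. i \<in> {..m} \<and> j \<in> {..n}}" by auto
    finally show ?thesis using S[OF that] by (simp add: src_sets_def chain_sets_def)
  qed
  obtain z where z: "z \<in> cells src q" "\<And>l. l \<le> q \<Longrightarrow> src_label q z l = S l"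
    by (rule nerve_iso_surj[OF iso_src, of q S]) (use mem mono in blast)+
  have "kappa m n q z = w"
  proof (rule nerve_iso_inj[OF iso_tgt _ w(3)])
    show "kappa m n q z \<in> cells tgt q"
      using simplicial_map_kappa z(1) unfolding simplicial_map_def by blast
    show "tgt_label q (kappa m n q z) l = tgt_label q w l" if "l \<le> q" for l
      using tgt_label_kappa[OF z(1) that] S[OF that] z(2)[OF that] that by (simp add: tgt_label_def)
  qed
  then show ?thesis using z(1) by blast
qed

section \<open>Identification of a fibre with the couplings\<close>

definition "fibre b = {a \<in> topspace (realization src). realization_map tgt (kappa m n) a = b}"

context
  fixes b assumes b: "b \<in> topspace (realization tgt)"
begin

lemma b_coend: "b \<in> coend tgt standard_simplex affine_op"
  using b by (simp add: topspace_realization)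

interpretation marginals m n "\<lambda>i. height tgt_label b (Inl i)" "\<lambda>j. height tgt_label b (Inr j)"
  by standard (rule tgt.height_bounds[OF b_coend])+

text \<open>Heights are functions on all of \<open>nat + nat\<close>, so comparing two of them
  includes the indices outside the grid.\<close>

lemma height_tgt_zero:
  "m < i \<Longrightarrow> height tgt_label b (Inl i) = 0" "n < j \<Longrightarrow> height tgt_label b (Inr j) = 0"
proof -
  obtain T where T: "T \<in> tgt_sets" "\<And>v. height tgt_label b v \<noteq> 0 \<Longrightarrow> v \<in> T"
    using tgt.height_bounds(3)[OF b_coend] by blast
  obtain A B where AB: "T = A <+> B" "A \<in> chain_sets {..m}" "B \<in> chain_sets {..n}"
    using T(1) unfolding tgt_sets_def by blast
  then have "A \<subseteq> {..m}" "B \<subseteq> {..n}" by (simp_all add: chain_sets_def)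
  then have "m < i \<Longrightarrow> Inl i \<notin> T" "n < j \<Longrightarrow> Inr j \<notin> T" unfolding AB(1) by auto
  then show "m < i \<Longrightarrow> height tgt_label b (Inl i) = 0" "n < j \<Longrightarrow> height tgt_label b (Inr j) = 0"
    using T(2) by blast+
qed

lemma fibre_nonempty: "fibre b \<noteq> {}"
proof -
  obtain q w t where r: "b = rclass tgt (q, w, t)" "w \<in> cells tgt q" "t \<in> standard_simplex q"
    using b_coend by (rule coendE)
  obtain z where z: "z \<in> cells src q" "kappa m n q z = w" using kappa_surj[OF r(2)] by blast
  have "rclass src (q, z, t) \<in> topspace (realization src)"
    unfolding topspace_realization coend_def using z r by blast
  moreover have "realization_map tgt (kappa m n) (rclass src (q, z, t)) = b"
    unfolding realization_map_class[OF simplicial_map_kappa] z(2) r(1) ..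
  ultimately show ?thesis unfolding fibre_def by blast
qed

lemma height_fibre_in_couplings:
  assumes "a \<in> fibre b" shows "height src_label a \<in> couplings"
proof -
  have a: "a \<in> topspace (realization src)" and ab: "realization_map tgt (kappa m n) a = b"
    using assms by (auto simp: fibre_def)
  have a': "a \<in> coend src standard_simplex affine_op" using a by (simp add: topspace_realization)
  note hk = height_kappa[OF a, unfolded ab]
  note nn = src.height_bounds(1)[OF a']
  obtain T where T: "T \<in> src_sets" "\<And>v. height src_label a v \<noteq> 0 \<Longrightarrow> v \<in> T"
    using src.height_bounds(3)[OF a'] by blast
  have supp: "i \<le> m \<and> j \<le> n" if "height src_label a (i, j) \<noteq> 0" for i j
    using T(2)[OF that] T(1) unfolding src_sets_def chain_sets_def by auto
  have chain: "height src_label a (i, j) = 0 \<or> height src_label a (i', j') = 0"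
    if "i < i'" "j' < j" for i j i' j'
  proof (rule ccontr)
    assume "\<not> ?thesis"
    then have "(i, j) \<in> T" "(i', j') \<in> T" using T(2) by auto
    then have "(i, j) \<le> (i', j') \<or> (i', j') \<le> (i, j)" using T(1) unfolding src_sets_def chain_sets_def by blast
    then show False using that by (auto simp: less_eq_prod_def)
  qed
  have row: "\<exists>j\<le>n. height src_label a (i, j) = height tgt_label b (Inl i)" for i
  proof -
    obtain j where j: "height src_label a (i, j) = height tgt_label b (Inl i)" using hk(2) by blast
    show ?thesis
    proof (cases "j \<le> n")
      case False
      \<comment> \<open>A maximum attained outside the grid is 0, so the whole row vanishes and
        column 0 attains it as well.\<close>
      then have "height tgt_label b (Inl i) = 0" using supp[of i j] j by auto
      then show ?thesis using hk(1)[of i 0] nn[of "(i, 0)"] by (intro exI[of _ 0]) auto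
    qed (use j in blast)
  qed
  have col: "\<exists>i\<le>m. height src_label a (i, j) = height tgt_label b (Inr j)" for j
  proof -
    obtain i where i: "height src_label a (i, j) = height tgt_label b (Inr j)" using hk(4) by blast
    show ?thesis
    proof (cases "i \<le> m")
      case False
      then have "height tgt_label b (Inr j) = 0" using supp[of i j] i by auto
      then show ?thesis using hk(3)[of 0 j] nn[of "(0, j)"] by (intro exI[of _ 0]) auto
    qed (use i in blast)
  qed
  show ?thesis
    unfolding couplings_def using nn supp chain hk(1,3) row col by simp
qed

text \<open>The superlevel sets of \<open>g\<close> are chains, so \<open>g\<close> is the height of
  some point \<open>a\<close>. The image of \<open>a\<close> has the row and column maxima of
  \<open>g\<close> as its height, the same as \<open>b\<close>, and heights determine
  points.\<close>

lemma coupling_is_height: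
  assumes g: "g \<in> couplings" shows "\<exists>a\<in>fibre b. height src_label a = g"
proof -
  note D = couplingsD[OF g]
  have g_le: "g (i, j) \<le> height tgt_label b (Inl i)" "g (i, j) \<le> height tgt_label b (Inr j)" for i j
    using D(2,3)[of i j] D(5,6)[of i j] tgt.height_bounds(1)[OF b_coend] by (cases "g (i, j) = 0"; auto)+
  \<comment> \<open>The height of \<open>b\<close> is 1 on a whole label, which contains some row;
    \<open>g\<close> attains the maximum of that row.\<close>
  have one: "\<exists>v. g v = 1"
  proof -
    obtain T where T: "T \<in> tgt_sets" "\<And>v. v \<in> T \<Longrightarrow> height tgt_label b v = 1"
      using tgt.height_bounds(4)[OF b_coend] by blast
    obtain A B where AB: "T = A <+> B" "A \<in> chain_sets {..m}"
      using T(1) unfolding tgt_sets_def by blast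
    then obtain i where i: "i \<in> A" "i \<le> m" unfolding chain_sets_def by blast
    then have "height tgt_label b (Inl i) = 1" using T(2) AB(1) by blast
    then show ?thesis using D(7)[OF i(2)] by metis
  qed
  have le1: "g v \<le> 1" for v
    using g_le(1)[of "fst v" "snd v"] tgt.height_bounds(2)[OF b_coend] order_trans by fastforce
  have super: "{v. s \<le> g v} \<in> src_sets" if s: "0 < s" "s \<le> 1" for s
  proof -
    have sub: "{v. s \<le> g v} \<subseteq> {(i, j) | i j. i \<in> {..m} \<and> j \<in> {..n}}"
    proof
      fix v assume "v \<in> {v. s \<le> g v}"
      then have "g (fst v, snd v) \<noteq> 0" using s by simp
      then have "fst v \<le> m" "snd v \<le> n" using D(2,3) by blast+
      then have "v = (fst v, snd v) \<and> fst v \<in> {..m} \<and> snd v \<in> {..n}" by simp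
      then show "v \<in> {(i, j) | i j. i \<in> {..m} \<and> j \<in> {..n}}" by blast
    qed
    moreover have "{(i, j) | i j. i \<in> {..m} \<and> j \<in> {..n}} = {..m} \<times> {..n}" by auto
    ultimately have "finite {v. s \<le> g v}" by (metis finite_SigmaI finite_atMost finite_subset)
    moreover have "{v. s \<le> g v} \<noteq> {}"
    proof -
      obtain v where "g v = 1" using one by blast
      then have "v \<in> {v. s \<le> g v}" using s by simp
      then show ?thesis by blast
    qed
    moreover have "v \<le> v' \<or> v' \<le> v" if v: "s \<le> g v" "s \<le> g v'" for v v'
    proof -
      obtain i j i' j' where ij: "v = (i, j)" "v' = (i', j')" by (metis surj_pair)
      have "g v \<noteq> 0" "g v' \<noteq> 0" using v s by auto
      then have "\<not> (i < i' \<and> j' < j)" "\<not> (i' < i \<and> j < j')"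
        using D(4)[of i i' j' j] D(4)[of i' i j j'] ij by auto
      then show ?thesis unfolding ij by (auto simp: less_eq_prod_def)
    qed
    ultimately show ?thesis using sub unfolding src_sets_def chain_sets_def by blast
  qed
  obtain a where a: "a \<in> coend src standard_simplex affine_op" "height src_label a = g"
    using src.height_surj[OF D(1) le1 one super] by blast
  have a': "a \<in> topspace (realization src)" using a(1) by (simp add: topspace_realization)
  let ?k = "realization_map tgt (kappa m n) a"
  note hk = height_kappa[OF a', unfolded a(2)]
  have k: "?k \<in> topspace (realization tgt)"
    using continuous_map_funspace[OF continuous_map_realization_map[OF simplicial_map_kappa]] a' by blast
  have "height tgt_label ?k (Inl i) = height tgt_label b (Inl i)" for i
  proof (rule antisym)
    show "height tgt_label ?k (Inl i) \<le> height tgt_label b (Inl i)"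
      using hk(2)[of i] g_le(1)[of i] by metis
    show "height tgt_label b (Inl i) \<le> height tgt_label ?k (Inl i)"
    proof (cases "i \<le> m")
      case True
      then show ?thesis using D(7)[OF True] hk(1)[of i] by metis
    next
      case False
      then show ?thesis using height_tgt_zero(1)[of i] hk(1)[of i 0] D(1)[of "(i, 0)"] by simp
    qed
  qed
  moreover have "height tgt_label ?k (Inr j) = height tgt_label b (Inr j)" for j
  proof (rule antisym)
    show "height tgt_label ?k (Inr j) \<le> height tgt_label b (Inr j)"
      using hk(4)[of j] g_le(2)[of _ j] by metis
    show "height tgt_label b (Inr j) \<le> height tgt_label ?k (Inr j)"
    proof (cases "j \<le> n")
      case True
      then show ?thesis using D(8)[OF True] hk(3)[of _ j] by metis
    next
      case False
      then show ?thesis using height_tgt_zero(2)[of j] hk(3)[of 0 j] D(1)[of "(0, j)"] by simp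
    qed
  qed
  ultimately have "height tgt_label ?k v = height tgt_label b v" for v by (cases v) simp_all
  then have "?k = b"
    using inj_onD[OF tgt.inj_on_height] k b_coend by (metis ext topspace_realization)
  then show ?thesis using a' a(2) unfolding fibre_def by blast
qed

lemma contractible_fibre: "contractible_space (subtopology (realization src) (fibre b))"
proof (rule src.contractible_space_subtopology_realization)
  show "fibre b \<subseteq> topspace (realization src)" by (auto simp: fibre_def)
  have "height src_label ` (fibre b) = couplings"
    using height_fibre_in_couplings coupling_is_height by blast
  then show "contractible_space (subtopology (powertop_real UNIV) (height src_label ` (fibre b)))"
    using contractible_couplings by simp
qed

end

end

theorem proposition1p3:
  fixes m n :: nat
  shows "simple_map (Sd (Delta m \<times>\<^sub>s Delta n)) (Sd (Delta m) \<times>\<^sub>s Sd (Delta n)) (kappa m n)"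
proof -
  interpret kappa_map m n .
  have "finite_sset src" "finite_sset tgt"
    using finite_sset_nerve_iso[OF src.iso src.sX src.finite_P]
      finite_sset_nerve_iso[OF tgt.iso tgt.sX tgt.finite_P] .
  then show ?thesis
    using fibre_nonempty contractible_fibre simplicial_map_kappa[of m n]
    by (simp add: simple_map_def Let_def fibre_def)
qed

end
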